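(* For every $d\in\mathbb{N}$ let $C_\gamma\ge\gamma_{d,1}\ge\gamma_{d,2}\ge\cdots\ge\gamma_{d,d}>0$, where $C_\gamma$ does not depend on $d$, and put $\gamma_{\boldsymbol\alpha}=\prod_{j=1}^d(\gamma_{d,j})^{\alpha_j}$ for $\boldsymbol\alpha\in\mathbb{N}_0^d$. Let $$F_d^\gamma=\{f\in C^\infty([0,1]^d)\mid \|f\mid F_d^\gamma\|<\infty\},\qquad \|f\mid F_d^\gamma\|=\sup_{\boldsymbol\alpha\in\mathbb{N}_0^d}\frac1{\gamma_{\boldsymbol\alpha}}\|D^{\boldsymbol\alpha}f\mid L_\infty([0,1]^d)\|,$$ (real-valued functions) and consider the uniform approximation problem $\mathrm{App}=(\mathrm{App}_d\colon F_d^\gamma\to L_\infty([0,1]^d))_{d\in\mathbb{N}}$, $\mathrm{App}_d(f)=f$, in the worst case setting with respect to the absolute error criterion. Fix as class of admissible algorithms either the class of linear algorithms or the class of algorithms using non-adaptive continuous or adaptive linear information. Then the following assertions are equivalent: (i) The problem $\mathrm{App}$ is weakly tractable. (ii) The problem $\mathrm{App}$ does not suffer from the curse of dimensionality. (iii) For all $\kappa>0$ we have $\lim_{d\to\infty}\frac1d\sum_{j=1}^d(\gamma_{d,j})^\kappa=0$. (iv) There exists $\kappa\in(0,1)$ such that $\lim_{d\to\infty}\frac1d\sum_{j=1}^d(\gamma_{d,j})^\kappa=0$.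
   Context: Algorithms using at most $n$ pieces of information on $f\in F_d^\gamma$: (a) linear algorithms $Af=\sum_{j=1}^nL_j(f)g_j$ with continuous linear functionals $L_j$ on $F_d^\gamma$ and $g_j\in L_\infty([0,1]^d)$; (b) algorithms $A=\varphi\circ N$ with arbitrary $\varphi\colon\mathbb{R}^n\to L_\infty([0,1]^d)$ and either $N(f)=(L_1(f),\dots,L_n(f))$ with continuous, not necessarily linear, $L_j$, or adaptive $N(f)=(y_1,\dots,y_n)$ with $y_1=L_1(f)$, $y_j=L_j(f;y_1,\dots,y_{j-1})$, where each $L_j(\cdot\,;y_1,\dots,y_{j-1})$ is a continuous linear functional. For $n=0$ an algorithm is a constant map ($0$ in the linear case). For a fixed class, $e(n,d)=\inf_A\sup_{\|f\mid F_d^\gamma\|\le1}\|f-Af\mid L_\infty([0,1]^d)\|$ over all algorithms of that class using at most $n$ pieces of information, $\varepsilon_d^{\mathrm{init}}=e(0,d)$ (which equals $1$ here), and $n(\varepsilon,d)=\min\{n\in\mathbb{N}_0\mid e(n,d)\le\varepsilon\}$. Curse of dimensionality: there are $\varepsilon>0$ and constants $C,\beta>0$ with $n(\varepsilon,d)\ge C(1+\beta)^d$ for infinitely many $d\in\mathbb{N}$. Weak tractability: $\ln n(\varepsilon_k,d_k)/(\varepsilon_k^{-1}+d_k)\to0$ for every sequence $((\varepsilon_k,d_k))_k\subset(0,1]\times\mathbb{N}$ with $\varepsilon_k<\varepsilon_{d_k}^{\mathrm{init}}$ for all $k$ and $\varepsilon_k^{-1}+d_k\to\infty$. *)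

theory Defs
  imports "HOL-Analysis.Analysis" "HOL-Probability.Essential_Supremum"
begin

text \<open>
  Points of \<open>\<real>\<^sup>d\<close> are functions on \<open>{1..d}\<close>, extensional in the sense of HOL-Library.FuncSet.
  Topological notions on the cube are those of the product topology on \<^typ>\<open>nat \<Rightarrow> real\<close>,
  whose trace on \<open>cube d\<close> is the Euclidean topology.
\<close>

definition cube :: "nat \<Rightarrow> (nat \<Rightarrow> real) set" where
  "cube d = {1..d} \<rightarrow>\<^sub>E {0..1}"

type_synonym cube_fun = "(nat \<Rightarrow> real) \<Rightarrow> real"

definition cube_measure :: "nat \<Rightarrow> (nat \<Rightarrow> real) measure" where
  "cube_measure d = completion (\<Pi>\<^sub>M j\<in>{1..d}. restrict_space lborel {0..1})"

definition Linf_norm :: "nat \<Rightarrow> cube_fun \<Rightarrow> ereal" where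
  "Linf_norm d g = esssup (cube_measure d) (\<lambda>x. ereal \<bar>g x\<bar>)"

text \<open>Representatives, not classes modulo null sets; all uses below are invariant.\<close>

definition Linf :: "nat \<Rightarrow> cube_fun set" where
  "Linf d = {g \<in> borel_measurable (cube_measure d). Linf_norm d g < \<infinity>}"


text \<open>
  At \<open>x j \<in> {0, 1}\<close> the partial derivative is one-sided. The value \<open>0\<close> off the cube fits the
  convention for elements of \<open>F\<close> below and has no other significance.
\<close>

definition partial_deriv :: "nat \<Rightarrow> nat \<Rightarrow> cube_fun \<Rightarrow> cube_fun" where
  "partial_deriv d j f =
     (\<lambda>x. if x \<in> cube d then vector_derivative (\<lambda>t. f (x(j := t))) (at (x j) within {0..1}) else 0)"

definition iterated_deriv :: "nat \<Rightarrow> nat list \<Rightarrow> cube_fun \<Rightarrow> cube_fun" where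
  "iterated_deriv d js f = fold (partial_deriv d) js f"

text \<open>
  \<open>C\<^sup>\<infinity>([0,1]\<^sup>d)\<close>: the partial derivatives of all orders, taken in any order of the variables,
  exist and are continuous on the closed cube. This agrees with the description by derivatives
  in the open cube that extend continuously to the closed cube.
\<close>

definition smooth_on_cube :: "nat \<Rightarrow> cube_fun \<Rightarrow> bool" where
  "smooth_on_cube d f \<longleftrightarrow>
     (\<forall>js \<in> lists {1..d}.
        continuous_on (cube d) (iterated_deriv d js f) \<and>
        (\<forall>j \<in> {1..d}. \<forall>x \<in> cube d.
           (\<lambda>t. iterated_deriv d js f (x(j := t))) differentiable (at (x j) within {0..1})))"

definition multi_indices :: "nat \<Rightarrow> (nat \<Rightarrow> nat) set" where
  "multi_indices d = {1..d} \<rightarrow>\<^sub>E UNIV"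

definition multi_deriv :: "nat \<Rightarrow> (nat \<Rightarrow> nat) \<Rightarrow> cube_fun \<Rightarrow> cube_fun" where
  "multi_deriv d \<alpha> f = iterated_deriv d (concat (map (\<lambda>j. replicate (\<alpha> j) j) [1..<d + 1])) f"

definition weight :: "(nat \<Rightarrow> nat \<Rightarrow> real) \<Rightarrow> nat \<Rightarrow> (nat \<Rightarrow> nat) \<Rightarrow> real" where
  "weight \<gamma> d \<alpha> = (\<Prod>j=1..d. \<gamma> d j ^ \<alpha> j)"

definition F_norm :: "(nat \<Rightarrow> nat \<Rightarrow> real) \<Rightarrow> nat \<Rightarrow> cube_fun \<Rightarrow> ereal" where
  "F_norm \<gamma> d f =
     (SUP \<alpha> \<in> multi_indices d. ereal (1 / weight \<gamma> d \<alpha>) * Linf_norm d (multi_deriv d \<alpha> f))"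

text \<open>A function on the cube is represented by its extension by \<open>0\<close>.\<close>

definition F :: "(nat \<Rightarrow> nat \<Rightarrow> real) \<Rightarrow> nat \<Rightarrow> cube_fun set" where
  "F \<gamma> d = {f. (\<forall>x. x \<notin> cube d \<longrightarrow> f x = 0) \<and> smooth_on_cube d f \<and> F_norm \<gamma> d f < \<infinity>}"


definition continuous_functional ::
  "(nat \<Rightarrow> nat \<Rightarrow> real) \<Rightarrow> nat \<Rightarrow> (cube_fun \<Rightarrow> real) \<Rightarrow> bool" where
  "continuous_functional \<gamma> d L \<longleftrightarrow>
     (\<forall>f \<in> F \<gamma> d. \<forall>\<epsilon>>0. \<exists>\<delta>>0. \<forall>g \<in> F \<gamma> d.
        F_norm \<gamma> d (\<lambda>x. g x - f x) < ereal \<delta> \<longrightarrow> \<bar>L g - L f\<bar> < \<epsilon>)"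

definition continuous_linear_functional ::
  "(nat \<Rightarrow> nat \<Rightarrow> real) \<Rightarrow> nat \<Rightarrow> (cube_fun \<Rightarrow> real) \<Rightarrow> bool" where
  "continuous_linear_functional \<gamma> d L \<longleftrightarrow>
     continuous_functional \<gamma> d L \<and>
     (\<forall>f \<in> F \<gamma> d. \<forall>g \<in> F \<gamma> d. L (\<lambda>x. f x + g x) = L f + L g) \<and>
     (\<forall>c. \<forall>f \<in> F \<gamma> d. L (\<lambda>x. c * f x) = c * L f)"

text \<open>
  In the following classes of algorithms \<open>\<real>\<^sup>m\<close> is the set of lists of length \<open>m\<close>, the argument
  \<open>n\<close> bounds the number \<open>m\<close> of pieces of information, and only the values of \<open>A\<close> on
  \<open>F \<gamma> d\<close> are relevant.
\<close>

definition linear_algorithms ::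
  "(nat \<Rightarrow> nat \<Rightarrow> real) \<Rightarrow> nat \<Rightarrow> nat \<Rightarrow> (cube_fun \<Rightarrow> cube_fun) set" where
  "linear_algorithms \<gamma> d n =
     {A. \<exists>m\<le>n. \<exists>L g.
        (\<forall>j \<in> {1..m}. continuous_linear_functional \<gamma> d (L j) \<and> g j \<in> Linf d) \<and>
        (\<forall>f \<in> F \<gamma> d. A f = (\<lambda>x. \<Sum>j=1..m. L j f * g j x))}"

definition nonadaptive_continuous_algorithms ::
  "(nat \<Rightarrow> nat \<Rightarrow> real) \<Rightarrow> nat \<Rightarrow> nat \<Rightarrow> (cube_fun \<Rightarrow> cube_fun) set" where
  "nonadaptive_continuous_algorithms \<gamma> d n =
     {A. \<exists>m\<le>n. \<exists>L \<phi>.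
        (\<forall>j \<in> {1..m}. continuous_functional \<gamma> d (L j)) \<and>
        (\<forall>y. length y = m \<longrightarrow> \<phi> y \<in> Linf d) \<and>
        (\<forall>f \<in> F \<gamma> d. A f = \<phi> (map (\<lambda>j. L j f) [1..<m + 1]))}"

text \<open>
  \<open>L ys\<close> is the functional evaluated after the values \<open>ys\<close> have been observed; its position in
  the sequence of evaluations is \<open>length ys + 1\<close>.
\<close>

primrec adaptive_information ::
  "(real list \<Rightarrow> cube_fun \<Rightarrow> real) \<Rightarrow> cube_fun \<Rightarrow> nat \<Rightarrow> real list" where
  "adaptive_information L f 0 = []"
| "adaptive_information L f (Suc m) =
     (let ys = adaptive_information L f m in ys @ [L ys f])"

definition adaptive_linear_algorithms ::
  "(nat \<Rightarrow> nat \<Rightarrow> real) \<Rightarrow> nat \<Rightarrow> nat \<Rightarrow> (cube_fun \<Rightarrow> cube_fun) set" where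
  "adaptive_linear_algorithms \<gamma> d n =
     {A. \<exists>m\<le>n. \<exists>L \<phi>.
        (\<forall>ys. length ys < m \<longrightarrow> continuous_linear_functional \<gamma> d (L ys)) \<and>
        (\<forall>y. length y = m \<longrightarrow> \<phi> y \<in> Linf d) \<and>
        (\<forall>f \<in> F \<gamma> d. A f = \<phi> (adaptive_information L f m))}"

definition nonlinear_algorithms ::
  "(nat \<Rightarrow> nat \<Rightarrow> real) \<Rightarrow> nat \<Rightarrow> nat \<Rightarrow> (cube_fun \<Rightarrow> cube_fun) set" where
  "nonlinear_algorithms \<gamma> d n =
     nonadaptive_continuous_algorithms \<gamma> d n \<union> adaptive_linear_algorithms \<gamma> d n"


text \<open>Below, \<open>algs d n\<close> is the class of admissible algorithms on \<open>F \<gamma> d\<close>.\<close>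

type_synonym algorithm_class = "nat \<Rightarrow> nat \<Rightarrow> (cube_fun \<Rightarrow> cube_fun) set"

definition minimal_error ::
  "(nat \<Rightarrow> nat \<Rightarrow> real) \<Rightarrow> algorithm_class \<Rightarrow> nat \<Rightarrow> nat \<Rightarrow> ereal" where
  "minimal_error \<gamma> algs n d =
     (INF A \<in> algs d n. SUP f \<in> {f \<in> F \<gamma> d. F_norm \<gamma> d f \<le> 1}. Linf_norm d (\<lambda>x. f x - A f x))"

definition initial_error ::
  "(nat \<Rightarrow> nat \<Rightarrow> real) \<Rightarrow> algorithm_class \<Rightarrow> nat \<Rightarrow> ereal" where
  "initial_error \<gamma> algs d = minimal_error \<gamma> algs 0 d"

text \<open>
  For \<open>\<epsilon> > 0\<close> the set over which the minimum is taken is nonempty: by the Lipschitz bound,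
  the unit ball of \<open>F \<gamma> d\<close> is approximated uniformly by piecewise constant interpolation.
\<close>

definition information_complexity ::
  "(nat \<Rightarrow> nat \<Rightarrow> real) \<Rightarrow> algorithm_class \<Rightarrow> real \<Rightarrow> nat \<Rightarrow> nat" where
  "information_complexity \<gamma> algs \<epsilon> d = (LEAST n. minimal_error \<gamma> algs n d \<le> ereal \<epsilon>)"

definition curse_of_dimensionality ::
  "(nat \<Rightarrow> nat \<Rightarrow> real) \<Rightarrow> algorithm_class \<Rightarrow> bool" where
  "curse_of_dimensionality \<gamma> algs \<longleftrightarrow>
     (\<exists>\<epsilon>>0. \<exists>C>0. \<exists>\<beta>>0.
        infinite {d. d \<ge> 1 \<and> real (information_complexity \<gamma> algs \<epsilon> d) \<ge> C * (1 + \<beta>) ^ d})"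

definition weakly_tractable ::
  "(nat \<Rightarrow> nat \<Rightarrow> real) \<Rightarrow> algorithm_class \<Rightarrow> bool" where
  "weakly_tractable \<gamma> algs \<longleftrightarrow>
     (\<forall>(\<epsilon> :: nat \<Rightarrow> real) (d :: nat \<Rightarrow> nat).
        (\<forall>k. 0 < \<epsilon> k \<and> \<epsilon> k \<le> 1 \<and> d k \<ge> 1 \<and> ereal (\<epsilon> k) < initial_error \<gamma> algs (d k)) \<longrightarrow>
        filterlim (\<lambda>k. 1 / \<epsilon> k + real (d k)) at_top sequentially \<longrightarrow>
        (\<lambda>k. ln (real (information_complexity \<gamma> algs (\<epsilon> k) (d k))) / (1 / \<epsilon> k + real (d k)))
          \<longlonglongrightarrow> 0)"

end

theory Submission
  imports Defs
begin

text \<open>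
  Upper bound. The Taylor coefficients of \<open>f\<close> at the origin are continuous linear functionals, and on the
  unit ball the Taylor terms are bounded by \<open>\<Prod>\<^sub>j \<gamma>\<^sub>j\<^bsup>\<alpha>\<^sub>j\<^esup> / \<alpha>\<^sub>j!\<close>. The sum of the \<open>\<kappa>\<close>-th powers of these bounds is
  at most \<open>exp (c * (\<Sum>\<^sub>j \<gamma>\<^sub>j\<^bsup>\<kappa>\<^esup>))\<close>, so if \<open>\<Sum>\<^sub>j \<gamma>\<^sub>j\<^bsup>\<kappa>\<^esup> = o(d)\<close>, keeping only the large terms needs subexponentially
  many functionals.

  Lower bound. If \<open>(1 / d) * (\<Sum>\<^sub>j \<gamma>\<^sub>j\<^bsup>\<kappa>\<^esup>)\<close> does not tend to \<open>0\<close>, then for infinitely many \<open>d\<close> a fixed proportion of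
  the weights is at least \<open>2 / m\<close> for a fixed \<open>m\<close>. Grouping the corresponding coordinates into \<open>s\<close> blocks
  of \<open>m\<close>, the functions that are multiaffine in the block means have \<open>F\<close>-norm equal to their sup norm and
  form a copy of \<open>\<ell>\<^sub>\<infinity>\<close> of dimension \<open>2\<^sup>s\<close>. Fewer than \<open>2\<^sup>s\<close> continuous functionals identify two points on
  opposite faces of its unit cube, hence two functions at sup distance \<open>2\<close>.
\<close>

section \<open>The essential supremum on the cube\<close>

text \<open>The two bounds meet because only the proportion of large weights matters. The weights
  are bounded, so an average of \<open>\<gamma> d j powr \<kappa>\<close> that stays away from 0
  forces, for any \<open>\<kappa> > 0\<close>, a positive proportion of weights above a fixed
  threshold. Thus the lower bound yields (iii) for every \<kappa>, while the upper bound starts from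
  a single \<open>\<kappa> < 1\<close>, and the implications close into a cycle. The threshold may
  lie far below 2, and then functions multiaffine in single coordinates have derivatives too large
  for the unit ball. Averaging over \<open>m\<close> coordinates divides the derivatives by
  \<open>m\<close>. It also divides the number of variables by \<open>m\<close>, but
  \<open>m\<close> does not depend on \<open>d\<close>, so the growth remains exponential. For
  linear information a dimension count would do. Continuous information calls for a topological
  statement in the manner of Borsuk and Ulam; the one about opposite faces is enough and comes from
  Kuhn's combinatorial lemma.\<close>

lemma space_cube_measure: "space (cube_measure d) = cube d"
  by (auto simp: cube_measure_def cube_def space_PiM space_restrict_space)

text \<open>Continuity refers to the topology on all functions
  \<open>nat \<Rightarrow> real\<close>, the measure to a product over \<open>{1..d}\<close>. The
  identity from one space to the other is measurable because it is so in each coordinate; the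
  coordinates outside \<open>{1..d}\<close> are constantly \<open>undefined\<close>.\<close>

lemma borel_measurable_cube_measure:
  fixes f :: "(nat \<Rightarrow> real) \<Rightarrow> real"
  assumes "continuous_on (cube d) f"
  shows "f \<in> borel_measurable (cube_measure d)"
proof -
  let ?M = "\<Pi>\<^sub>M j\<in>{1..d}. restrict_space lborel {0..1::real}"
  have "(\<lambda>x. x i) \<in> borel_measurable ?M" for i
  proof (cases "i \<in> {1..d}")
    case True
    then have "(\<lambda>x. x i) \<in> measurable ?M (restrict_space lborel {0..1::real})"
      by (rule measurable_component_singleton)
    then show ?thesis
      by (subst (asm) measurable_restrict_space2_iff) auto
  next
    case False
    then have "(\<lambda>x. x i) \<in> borel_measurable ?M \<longleftrightarrow> (\<lambda>x. undefined::real) \<in> borel_measurable ?M"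
      by (intro measurable_cong) (auto simp: space_PiM PiE_iff extensional_def)
    then show ?thesis by simp
  qed
  then have "(\<lambda>x. x) \<in> borel_measurable ?M"
    by (rule measurable_coordinatewise_then_product)
  then have "(\<lambda>x. x) \<in> measurable ?M (restrict_space borel (cube d))"
    by (rule measurable_restrict_space2[rotated]) (auto simp: space_PiM cube_def space_restrict_space)
  moreover have "f \<in> borel_measurable (restrict_space borel (cube d))"
    using assms by (rule borel_measurable_continuous_on_restrict)
  ultimately have "(\<lambda>x. f x) \<in> borel_measurable ?M"
    by (rule measurable_compose)
  then show ?thesis
    unfolding cube_measure_def by (intro measurable_completion) simp
qed

lemma emeasure_unit_interval_open_pos:
  fixes X :: "real set"
  assumes "open X" "t \<in> X" "t \<in> {0..1}"
  shows "emeasure lborel (X \<inter> {0..1}) > 0"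
proof -
  obtain e where e: "e > 0" "cball t e \<subseteq> X"
    using assms open_contains_cball by blast
  define a where "a = max 0 (t - e)"
  define b where "b = min 1 (t + e)"
  have ab: "a < b" "{a..b} \<subseteq> X \<inter> {0..1}"
    using e assms by (auto simp: a_def b_def cball_def dist_real_def subset_iff abs_le_iff)
  have "0 < emeasure lborel {a..b}"
    using ab by simp
  also have "\<dots> \<le> emeasure lborel (X \<inter> {0..1})"
    using ab assms by (intro emeasure_mono) auto
  finally show ?thesis .
qed

text \<open>A violation at \<open>x0\<close> would persist on the trace of an open box around
  \<open>x0\<close>, and this trace has positive measure even if \<open>x0\<close> lies on the
  boundary of the cube.\<close>

lemma AE_cube_measure_continuousD:
  assumes f: "continuous_on (cube d) f" and ae: "AE x in cube_measure d. f x \<le> (c::real)"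
    and x0: "x0 \<in> cube d"
  shows "f x0 \<le> c"
proof (rule ccontr)
  assume "\<not> f x0 \<le> c"
  let ?N = "\<lambda>j::nat. restrict_space lborel {0..1::real}"
  let ?M = "PiM {1..d} ?N"
  interpret product_sigma_finite ?N
    unfolding product_sigma_finite_def
    using sigma_finite_measure_restrict_space[OF lborel.sigma_finite_measure_axioms, of "{0..1::real}"] by auto
  obtain T where T: "open T" "T \<inter> cube d = f -` {c<..} \<inter> cube d"
    using f continuous_on_open_invariant[of "cube d" f] open_greaterThan by metis
  have "x0 \<in> T"
    using T(2) x0 \<open>\<not> f x0 \<le> c\<close> by auto
  have "openin (product_topology (\<lambda>i::nat. euclidean::real topology) UNIV) T"
    using T(1) by (subst euclidean_product_topology) simp
  from product_topology_open_contains_basis[OF this \<open>x0 \<in> T\<close>]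
  obtain X where X: "x0 \<in> Pi\<^sub>E UNIV X" "\<And>i. open (X i)" "Pi\<^sub>E UNIV X \<subseteq> T"
    by auto
  let ?B = "Pi\<^sub>E {1..d} (\<lambda>j. X j \<inter> {0..1})"
  have B: "f x > c" if "x \<in> ?B" for x
  proof -
    have "x \<in> cube d"
      using that by (auto simp: cube_def PiE_iff)
    moreover
    have "x j \<in> X j" for j
    proof (cases "j \<in> {1..d}")
      case True
      then show ?thesis using that by auto
    next
      case False
      then have "x j = x0 j"
        using PiE_arb[OF that False] PiE_arb[OF x0[unfolded cube_def] False] by simp
      then show ?thesis using X(1) by auto
    qed
    then have "x \<in> T"
      by (intro subsetD[OF X(3)]) (simp add: PiE_iff)
    ultimately have "x \<in> f -` {c<..} \<inter> cube d"
      using T(2) by blast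
    then show ?thesis by simp
  qed
  have sB: "X j \<inter> {0..1} \<in> sets (?N j)" for j
    using X(2) by (auto simp: sets_restrict_space_iff)
  have "emeasure ?M ?B = (\<Prod>j\<in>{1..d}. emeasure (?N j) (X j \<inter> {0..1}))"
    by (rule emeasure_PiM) (use sB in auto)
  also have "\<dots> = (\<Prod>j\<in>{1..d}. emeasure lborel (X j \<inter> {0..1}))"
    by (intro prod.cong refl emeasure_restrict_space) auto
  also have "\<dots> \<noteq> 0"
  proof -
    have "emeasure lborel (X j \<inter> {0..1}) \<noteq> 0" if "j \<in> {1..d}" for j
      using emeasure_unit_interval_open_pos[OF X(2), of "x0 j" j] X(1) x0 that
      by (auto simp: cube_def PiE_iff)
    then show ?thesis
      by (simp add: prod_zero_iff)
  qed
  finally have nz: "emeasure ?M ?B \<noteq> 0" .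
  have "AE x in ?M. f x \<le> c"
    using ae unfolding cube_measure_def AE_completion_iff .
  then have "AE x in ?M. x \<notin> ?B"
    by (rule AE_mp) (use B in \<open>auto simp: not_less[symmetric]\<close>)
  then have "emeasure ?M ?B = 0"
    using sB by (subst (asm) AE_iff_measurable[of ?B]) (auto simp: space_PiM intro!: sets_PiM_I_finite)
  with nz show False by contradiction
qed

lemma Linf_norm_le:
  assumes f: "continuous_on (cube d) f" and "\<And>x. x \<in> cube d \<Longrightarrow> \<bar>f x\<bar> \<le> c"
  shows "Linf_norm d f \<le> ereal c"
  unfolding Linf_norm_def
proof (rule esssup_I)
  show "(\<lambda>x. ereal \<bar>f x\<bar>) \<in> borel_measurable (cube_measure d)"
    using borel_measurable_cube_measure[OF f] by measurable
  show "AE x in cube_measure d. ereal \<bar>f x\<bar> \<le> ereal c"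
    using assms by (intro AE_I2) (auto simp: space_cube_measure)
qed

lemma Linf_norm_ge:
  assumes f: "continuous_on (cube d) f" and x: "x \<in> cube d"
  shows "ereal \<bar>f x\<bar> \<le> Linf_norm d f"
proof (rule ccontr)
  assume "\<not> ?thesis"
  then obtain r where r: "Linf_norm d f < ereal r" "r < \<bar>f x\<bar>"
    using ereal_dense2[of "Linf_norm d f" "ereal \<bar>f x\<bar>"] by (auto simp: not_le)
  have "AE x in cube_measure d. \<bar>f x\<bar> \<le> r"
    using esssup_AE[where M = "cube_measure d" and f = "\<lambda>x. ereal \<bar>f x\<bar>"]
  proof (rule AE_mp, intro AE_I2 impI)
    fix x assume "ereal \<bar>f x\<bar> \<le> esssup (cube_measure d) (\<lambda>x. ereal \<bar>f x\<bar>)"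
    with r(1) show "\<bar>f x\<bar> \<le> r"
      unfolding Linf_norm_def by (metis ereal_less_eq(3) less_imp_le order.trans)
  qed
  then have "\<bar>f x\<bar> \<le> r"
    using AE_cube_measure_continuousD[of d "\<lambda>x. \<bar>f x\<bar>"] f x by (auto intro: continuous_intros)
  with r show False by simp
qed

lemma bounded_continuous_in_Linf:
  assumes "continuous_on (cube d) f" "\<And>x. x \<in> cube d \<Longrightarrow> \<bar>f x\<bar> \<le> c"
  shows "f \<in> Linf d"
  using Linf_norm_le[OF assms] borel_measurable_cube_measure[OF assms(1)]
  by (auto simp: Linf_def intro: le_less_trans)

text \<open>The function \<open>a\<close> is arbitrary. Its distances to \<open>u\<close> and
  \<open>v\<close> are controlled only almost everywhere, so the triangle inequality is applied
  there, and continuity of \<open>\<bar>u x - v x\<bar>\<close> carries the resulting bound to the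
  given point.\<close>

lemma Linf_norm_separated:
  assumes u: "continuous_on (cube d) u" and v: "continuous_on (cube d) v"
    and x: "x \<in> cube d" and uv: "2 \<le> \<bar>u x - v x\<bar>"
  shows "1 \<le> Linf_norm d (\<lambda>x. u x - a x) \<or> 1 \<le> Linf_norm d (\<lambda>x. v x - a x)"
proof (rule ccontr)
  assume "\<not> ?thesis"
  then obtain r s where r: "Linf_norm d (\<lambda>x. u x - a x) < ereal r" "r < 1"
    and s: "Linf_norm d (\<lambda>x. v x - a x) < ereal s" "s < 1"
    using ereal_dense2[of _ "1"] by (auto simp: not_le one_ereal_def) metis
  have bd: "AE x in cube_measure d. \<bar>g x\<bar> < c" if "Linf_norm d g < ereal c" for g c
    using esssup_AE[where M = "cube_measure d" and f = "\<lambda>x. ereal \<bar>g x\<bar>"]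
  proof (rule AE_mp, intro AE_I2 impI)
    fix x assume "ereal \<bar>g x\<bar> \<le> esssup (cube_measure d) (\<lambda>x. ereal \<bar>g x\<bar>)"
    with that show "\<bar>g x\<bar> < c"
      unfolding Linf_norm_def by (metis ereal_less(2) less_ereal.simps(1) le_less_trans)
  qed
  from bd[OF r(1)] bd[OF s(1)] have "AE x in cube_measure d. \<bar>u x - v x\<bar> \<le> r + s"
    by eventually_elim linarith
  moreover have "continuous_on (cube d) (\<lambda>x. \<bar>u x - v x\<bar>)"
    by (intro continuous_intros u v)
  ultimately have "\<bar>u x - v x\<bar> \<le> r + s"
    using AE_cube_measure_continuousD[of d "\<lambda>x. \<bar>u x - v x\<bar>" "r + s" x] x by blast
  with r s uv show False by simp
qed

section \<open>Opposite faces of a cube\<close>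

text \<open>Tychonoff over all indices: outside \<open>I\<close> the factor is the singleton
  \<open>{undefined}\<close>.\<close>

lemma compact_PiE_unit_interval: "compact (I \<rightarrow>\<^sub>E {0..1::real})"
proof -
  let ?S = "\<lambda>i. if i \<in> I then {0..1::real} else {undefined}"
  have "compactin (product_topology (\<lambda>i. euclidean) UNIV) (Pi\<^sub>E UNIV ?S)"
    by (rule iffD2[OF compactin_PiE]) simp
  moreover have "Pi\<^sub>E UNIV ?S = I \<rightarrow>\<^sub>E {0..1}"
    by (auto simp: PiE_iff extensional_def split: if_splits)
  ultimately show ?thesis
    by (simp add: euclidean_product_topology)
qed

lemma fun_dist_small:
  assumes "\<eta> > (0::real)"
  shows "\<exists>\<tau>>0. \<forall>x y :: nat \<Rightarrow> real. (\<forall>i. \<bar>x i - y i\<bar> \<le> \<tau>) \<longrightarrow> dist x y < \<eta>"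
proof -
  obtain N where N: "(1/2) ^ N < \<eta> / 2"
    using real_arch_pow_inv[of "\<eta>/2" "1/2"] assms by auto
  \<comment> \<open>\<open>dist_fun_le_dist_first_terms\<close> bounds the distance by twice the
    largest of the first coordinate distances plus \<open>(1/2) ^ N\<close>; with
    \<open>\<eta> / 4\<close> each of the two parts stays within \<open>\<eta> / 2\<close>.\<close>
  have "dist x y < \<eta>" if "\<forall>i. \<bar>x i - y i\<bar> \<le> \<eta> / 4" for x y :: "nat \<Rightarrow> real"
  proof -
    have "Max {dist (x (from_nat n)) (y (from_nat n)) |n. n \<le> N} \<le> \<eta> / 4"
    proof (rule Max.boundedI)
      have "{dist (x (from_nat n)) (y (from_nat n)) |n. n \<le> N} = (\<lambda>n. dist (x (from_nat n)) (y (from_nat n))) ` {..N}"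
        by auto
      then show "finite {dist (x (from_nat n)) (y (from_nat n)) |n. n \<le> N}" by simp
    qed (use that in \<open>auto simp: dist_real_def\<close>)
    with dist_fun_le_dist_first_terms[of x y N] N show ?thesis by linarith
  qed
  then show ?thesis
    using assms by (intro exI[of _ "\<eta> / 4"]) simp
qed

lemma floor_stable:
  fixes t t' h :: real
  assumes "\<And>a::int. h \<le> \<bar>t - of_int a\<bar>" "\<bar>t' - t\<bar> < h"
  shows "\<lfloor>t'\<rfloor> = \<lfloor>t\<rfloor>"
proof -
  have "real_of_int \<lfloor>t\<rfloor> \<le> t" "t < real_of_int \<lfloor>t\<rfloor> + 1"
    using floor_correct[of t] by simp_all
  then have "h \<le> t - real_of_int \<lfloor>t\<rfloor>" "h \<le> real_of_int \<lfloor>t\<rfloor> + 1 - t"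
    using assms(1)[of "\<lfloor>t\<rfloor>"] assms(1)[of "\<lfloor>t\<rfloor> + 1"] by simp_all
  with assms(2) show ?thesis
    by (intro floor_unique) linarith+
qed

text \<open>Pigeonhole: there are \<open>n + 1\<close> shifts and \<open>n\<close> coordinates, and
  a coordinate spoils at most one shift, since two shifts differ modulo 1 by at least
  \<open>1 / (n + 1)\<close>, twice the distance that has to be kept.\<close>

lemma exists_shift_away_from_integers:
  fixes t :: "nat \<Rightarrow> real"
  shows "\<exists>i\<le>n. \<forall>j<n. \<forall>a. 1 / (2 * real (n + 1)) \<le> \<bar>t j - real i / real (n + 1) - of_int a\<bar>"
proof (rule ccontr)
  assume no: "\<not> ?thesis"
  have "\<forall>i\<in>{..n}. \<exists>j. \<exists>a. j < n \<and> \<bar>t j - real i / real (n + 1) - of_int a\<bar> < 1 / (2 * real (n + 1))"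
  proof (intro ballI, rule ccontr)
    fix i assume i: "i \<in> {..n}"
      and *: "\<not> (\<exists>j. \<exists>a. j < n \<and> \<bar>t j - real i / real (n + 1) - of_int a\<bar> < 1 / (2 * real (n + 1)))"
    have "\<forall>j<n. \<forall>a. 1 / (2 * real (n + 1)) \<le> \<bar>t j - real i / real (n + 1) - of_int a\<bar>"
    proof (intro allI impI, rule ccontr)
      fix j a assume "j < n" "\<not> 1 / (2 * real (n + 1)) \<le> \<bar>t j - real i / real (n + 1) - of_int a\<bar>"
      then have "j < n \<and> \<bar>t j - real i / real (n + 1) - of_int a\<bar> < 1 / (2 * real (n + 1))"
        unfolding not_le by (rule conjI)
      then show False using * by (elim notE) (intro exI)
    qed
    moreover have "i \<le> n" using i by simp
    ultimately show False using no by (elim notE) (intro exI conjI)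
  qed
  from bchoice[OF this] obtain J where
    "\<forall>i\<in>{..n}. \<exists>a. J i < n \<and> \<bar>t (J i) - real i / real (n + 1) - of_int a\<bar> < 1 / (2 * real (n + 1))"
    by blast
  from bchoice[OF this] obtain a where
    "\<forall>i\<in>{..n}. J i < n \<and> \<bar>t (J i) - real i / real (n + 1) - of_int (a i)\<bar> < 1 / (2 * real (n + 1))"
    by blast
  then have J: "\<And>i. i \<le> n \<Longrightarrow> J i < n"
    and a: "\<And>i. i \<le> n \<Longrightarrow> \<bar>t (J i) - real i / real (n + 1) - of_int (a i)\<bar> < 1 / (2 * real (n + 1))"
    by blast+
  have False if ij: "i < i'" "i' \<le> n" "J i = J i'" for i i'
  proof -
    have scaled: "\<bar>t (J k) * real (n + 1) - real k - of_int (a k) * real (n + 1)\<bar> < 1 / 2" if "k \<le> n" for k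
    proof -
      have "\<bar>t (J k) - real k / real (n + 1) - of_int (a k)\<bar> * real (n + 1) < 1 / (2 * real (n + 1)) * real (n + 1)"
        using a[OF that] by (intro mult_strict_right_mono) auto
      also have "\<bar>t (J k) - real k / real (n + 1) - of_int (a k)\<bar> * real (n + 1) =
          \<bar>(t (J k) - real k / real (n + 1) - of_int (a k)) * real (n + 1)\<bar>"
        by (simp add: abs_mult)
      also have "(t (J k) - real k / real (n + 1) - of_int (a k)) * real (n + 1) =
          t (J k) * real (n + 1) - real k - of_int (a k) * real (n + 1)"
        unfolding left_diff_distrib by (simp del: of_nat_add of_nat_Suc)
      also have "1 / (2 * real (n + 1)) * real (n + 1) = 1 / 2"
        by (simp del: of_nat_add of_nat_Suc)
      finally show ?thesis .
    qed
    \<comment> \<open>After scaling by \<open>n + 1\<close> the two near misses leave an integer of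
      absolute value below 1, so \<open>i' - i\<close> would be a multiple of
      \<open>n + 1\<close>.\<close>
    have "\<bar>(real i' - real i) - (of_int (a i) * real (n + 1) - of_int (a i') * real (n + 1))\<bar> < 1"
      using scaled[of i] scaled[of i'] ij unfolding ij(3) by linarith
    then have "\<bar>(real i' - real i) - of_int (a i - a i') * real (n + 1)\<bar> < 1"
      unfolding of_int_diff left_diff_distrib .
    moreover have "real_of_int ((int i' - int i) - (a i - a i') * int (n + 1)) =
        (real i' - real i) - of_int (a i - a i') * real (n + 1)"
      by simp
    ultimately have "real_of_int \<bar>(int i' - int i) - (a i - a i') * int (n + 1)\<bar> < 1"
      by (simp only: of_int_abs)
    then have "(int i' - int i) = (a i - a i') * int (n + 1)"
      by linarith
    moreover have "0 < int i' - int i" "int i' - int i < int (n + 1)"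
      using ij by auto
    ultimately show False
      by (metis dvd_triv_right zdvd_not_zless)
  qed
  then have "inj_on J {..n}"
    by (intro linorder_inj_onI) auto
  moreover have "J ` {..n} \<subseteq> {..<n}"
    using J by auto
  ultimately have "card {..n} \<le> card {..<n}"
    by (intro card_inj_on_le[of J]) auto
  then show False by simp
qed

text \<open>Compactness of the set of pairs on opposite faces turns pointwise separation into a
  uniform gap.\<close>

lemma opposite_faces_uniformly_separated:
  fixes N :: "nat \<Rightarrow> (nat \<Rightarrow> real) \<Rightarrow> real"
  assumes cont: "\<And>j. j < n \<Longrightarrow> continuous_on ({..<M} \<rightarrow>\<^sub>E {0..1}) (N j)"
    and sep: "\<And>x z i. x \<in> {..<M} \<rightarrow>\<^sub>E {0..1} \<Longrightarrow> z \<in> {..<M} \<rightarrow>\<^sub>E {0..1} \<Longrightarrow> i < M \<Longrightarrow> x i = 0 \<Longrightarrow> z i = 1 \<Longrightarrow>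
        \<exists>j<n. N j x \<noteq> N j z"
  shows "\<exists>\<delta>>0. \<forall>x \<in> {..<M} \<rightarrow>\<^sub>E {0..1}. \<forall>z \<in> {..<M} \<rightarrow>\<^sub>E {0..1}. \<forall>i<M. x i = 0 \<longrightarrow> z i = 1 \<longrightarrow>
        (\<exists>j<n. \<delta> \<le> \<bar>N j x - N j z\<bar>)"
proof -
  let ?K = "{..<M} \<rightarrow>\<^sub>E {0..1::real}"
  define S where "S = (?K \<times> ?K) \<inter> (\<Union>i<M. {p. fst p i = 0} \<inter> {p. snd p i = 1})"
  define g where "g p = (\<Sum>j<n. \<bar>N j (fst p) - N j (snd p)\<bar>)" for p
  have "closed (\<Union>i<M. {p::(nat\<Rightarrow>real)\<times>(nat\<Rightarrow>real). fst p i = 0} \<inter> {p. snd p i = 1})"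
    by (intro closed_UN closed_Int closed_Collect_eq ballI finite_lessThan
        continuous_on_product_then_coordinatewise[of _ fst]
        continuous_on_product_then_coordinatewise[of _ snd] continuous_intros)
  then have cS: "compact S"
    unfolding S_def by (intro compact_Int_closed compact_Times compact_PiE_unit_interval)
  have "continuous_on (?K \<times> ?K) (\<lambda>p. N j (fst p))" "continuous_on (?K \<times> ?K) (\<lambda>p. N j (snd p))" if "j < n" for j
    by (rule continuous_on_compose2[OF cont[OF that]]; auto intro: continuous_intros)+
  then have "continuous_on (?K \<times> ?K) g"
    unfolding g_def by (intro continuous_intros) auto
  then have cg: "continuous_on S g"
    by (rule continuous_on_subset) (auto simp: S_def)
  have pos: "g p > 0" if pS: "p \<in> S" for p
  proof -
    obtain i where "i < M" "fst p i = 0" "snd p i = 1" "fst p \<in> ?K" "snd p \<in> ?K"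
      using pS unfolding S_def by (auto simp only: Int_iff UN_iff mem_Times_iff mem_Collect_eq lessThan_iff)
    then obtain j where "j < n" "N j (fst p) \<noteq> N j (snd p)"
      using sep by blast
    then have "g p \<ge> \<bar>N j (fst p) - N j (snd p)\<bar>" "\<bar>N j (fst p) - N j (snd p)\<bar> > 0"
      unfolding g_def by (auto intro: member_le_sum)
    then show ?thesis by linarith
  qed
  have "\<exists>\<mu>>0. \<forall>p\<in>S. \<mu> \<le> g p"
  proof (cases "S = {}")
    case False
    from continuous_attains_inf[OF cS False cg] pos show ?thesis by blast
  qed (auto intro: exI[of _ 1])
  then obtain \<mu> where \<mu>: "\<mu> > 0" "\<And>p. p \<in> S \<Longrightarrow> \<mu> \<le> g p" by blast
  show ?thesis
  \<comment> \<open>Dividing by \<open>n + 1\<close> rather than \<open>n\<close> keeps the sum of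
    \<open>n\<close> small terms strictly below \<open>\<mu>\<close> and covers
    \<open>n = 0\<close>.\<close>
  proof (intro exI[of _ "\<mu> / (n + 1)"] conjI ballI allI impI)
    show "\<mu> / (n + 1) > 0" using \<mu> by simp
    fix x z i assume *: "x \<in> ?K" "z \<in> ?K" "i < M" "x i = 0" "z i = 1"
    show "\<exists>j<n. \<mu> / (n + 1) \<le> \<bar>N j x - N j z\<bar>"
    proof (rule ccontr)
      assume "\<not> ?thesis"
      then have "g (x, z) \<le> (\<Sum>j<n. \<mu> / (n + 1))"
        unfolding g_def by (intro sum_mono) (auto simp: not_le intro: less_imp_le)
      also have "\<dots> < \<mu>" using \<mu> by (simp add: field_simps)
      finally show False using \<mu>(2)[of "(x, z)"] * by (force simp: S_def)
    qed
  qed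
qed

text \<open>
  A Lebesgue covering argument: the sets of points whose information vector, shifted by
  \<open>i / (n + 1)\<close> in all coordinates, stays away from the grid \<open>\<int>\<^sup>n\<close> form, for \<open>i = 0, \<dots>, n\<close>, a
  cover by families of separated pieces, none of which joins two opposite faces.
\<close>

theorem opposite_faces_share_fibre:
  fixes N :: "nat \<Rightarrow> (nat \<Rightarrow> real) \<Rightarrow> real"
  assumes cont: "\<forall>j<n. continuous_on ({..<M} \<rightarrow>\<^sub>E {0..1}) (N j)"
    and "n < M"
  shows "\<exists>x \<in> {..<M} \<rightarrow>\<^sub>E {0..1}. \<exists>z \<in> {..<M} \<rightarrow>\<^sub>E {0..1}. \<exists>i<M. x i = 0 \<and> z i = 1 \<and> (\<forall>j<n. N j x = N j z)"
proof (rule ccontr)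
  assume no: "\<not> ?thesis"
  let ?K = "{..<M} \<rightarrow>\<^sub>E {0..1::real}"
  have sep: "\<exists>j<n. N j x \<noteq> N j z"
    if "x \<in> ?K" "z \<in> ?K" "i < M" "x i = 0" "z i = 1" for x z i
    using that no by blast
  have "\<exists>\<delta>>0. \<forall>x\<in>?K. \<forall>z\<in>?K. \<forall>i<M. x i = 0 \<longrightarrow> z i = 1 \<longrightarrow> (\<exists>j<n. \<delta> \<le> \<bar>N j x - N j z\<bar>)"
    by (rule opposite_faces_uniformly_separated) (rule cont[rule_format], assumption, fact sep)
  then obtain \<delta> where "\<delta> > 0" and
    "\<forall>x\<in>?K. \<forall>z\<in>?K. \<forall>i<M. x i = 0 \<longrightarrow> z i = 1 \<longrightarrow> (\<exists>j<n. \<delta> \<le> \<bar>N j x - N j z\<bar>)"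
    by (elim exE conjE)
  then have \<delta>: "\<delta> > 0" "\<And>x z i. x \<in> ?K \<Longrightarrow> z \<in> ?K \<Longrightarrow> i < M \<Longrightarrow> x i = 0 \<Longrightarrow> z i = 1 \<Longrightarrow>
        \<exists>j<n. \<delta> \<le> \<bar>N j x - N j z\<bar>"
    by simp_all
  define h where "h = 1 / (2 * real (n + 1))"
  have h: "h > 0" by (simp add: h_def)
  have "\<forall>j\<in>{..<n}. \<exists>\<eta>>0. \<forall>x\<in>?K. \<forall>y\<in>?K. dist y x < \<eta> \<longrightarrow> \<bar>N j y - N j x\<bar> < h * \<delta>"
  proof
    fix j assume "j \<in> {..<n}"
    then have "uniformly_continuous_on ?K (N j)"
      by (intro compact_uniformly_continuous cont[rule_format] compact_PiE_unit_interval) simp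
    then show "\<exists>\<eta>>0. \<forall>x\<in>?K. \<forall>y\<in>?K. dist y x < \<eta> \<longrightarrow> \<bar>N j y - N j x\<bar> < h * \<delta>"
      using mult_pos_pos[OF h \<delta>(1)] unfolding uniformly_continuous_on_def dist_real_def by simp
  qed
  from bchoice[OF this] obtain e where
    "\<forall>j\<in>{..<n}. e j > 0 \<and> (\<forall>x\<in>?K. \<forall>y\<in>?K. dist y x < e j \<longrightarrow> \<bar>N j y - N j x\<bar> < h * \<delta>)"
    by (elim exE)
  then have e: "\<And>j. j < n \<Longrightarrow> e j > 0"
    "\<And>j x y. j < n \<Longrightarrow> x \<in> ?K \<Longrightarrow> y \<in> ?K \<Longrightarrow> dist y x < e j \<Longrightarrow> \<bar>N j y - N j x\<bar> < h * \<delta>"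
    by simp_all
  \<comment> \<open>\<open>insert 1\<close> keeps the minimum meaningful for
    \<open>n = 0\<close>.\<close>
  define \<eta> where "\<eta> = Min (insert 1 (e ` {..<n}))"
  have \<eta>: "\<eta> > 0" "\<And>j. j < n \<Longrightarrow> \<eta> \<le> e j"
    using e(1) by (auto simp: \<eta>_def)
  from fun_dist_small[OF \<eta>(1)] obtain \<tau> where "\<tau> > 0" and
    "\<forall>x y :: nat \<Rightarrow> real. (\<forall>i. \<bar>x i - y i\<bar> \<le> \<tau>) \<longrightarrow> dist x y < \<eta>"
    by (elim exE conjE)
  then have \<tau>: "\<tau> > 0" "\<And>x y :: nat \<Rightarrow> real. (\<forall>i. \<bar>x i - y i\<bar> \<le> \<tau>) \<Longrightarrow> dist x y < \<eta>"
    by simp_all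
  obtain p :: nat where p: "p > 0" "1 / real p < \<tau>"
    using \<tau>(1) by (metis real_arch_inverse inverse_eq_divide gr0I)
  define P where "P r = restrict (\<lambda>i. real (r i) / real p) {..<M}" for r :: "nat \<Rightarrow> nat"
  have PK: "P r \<in> ?K" if "\<forall>i<M. r i \<le> p" for r
    using that p by (auto simp: P_def)
  \<comment> \<open>The number, in direction \<open>j\<close>, of the cell of side
    \<open>\<delta>\<close> that contains the information at \<open>x\<close>, when the grid is
    moved by \<open>i / (n + 1)\<close> of a side. Equal keys mean information less than
    \<open>\<delta>\<close> apart in every component.\<close>
  define key where "key i x j = \<lfloor>N j x / \<delta> - real i / real (n + 1)\<rfloor>" for i j x
  \<comment> \<open>Label 1 marks the grid points that share a cell, for the shift \<open>i\<close>,
    with a point of the face \<open>z i = 1\<close>; the index \<open>i\<close> serves as a shift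
    and as a coordinate. If \<open>r i = 0\<close>, a shared cell would contradict
    \<open>\<delta>(2)\<close>; if \<open>r i = p\<close>, the grid point itself lies on the
    face.\<close>
  define label where "label r i = (if \<exists>z\<in>?K. z i = 1 \<and> (\<forall>j<n. key i z j = key i (P r) j) then 1 else 0::nat)" for r i
  obtain q where q: "\<forall>i<M. q i < p"
    and l: "\<forall>i<M. \<exists>r s. (\<forall>j<M. q j \<le> r j \<and> r j \<le> q j + 1) \<and> (\<forall>j<M. q j \<le> s j \<and> s j \<le> q j + 1) \<and>
      label r i \<noteq> label s i"
  proof (rule kuhn_lemma[of p M label])
    show "\<forall>r. (\<forall>i<M. r i \<le> p) \<longrightarrow> (\<forall>i<M. r i = 0 \<longrightarrow> label r i = 0)"
    proof (intro allI impI)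
      fix r i assume r: "\<forall>i<M. r i \<le> p" and i: "i < M" "r i = 0"
      have "\<not> (\<forall>j<n. key i z j = key i (P r) j)" if z: "z \<in> ?K" "z i = 1" for z
      proof
        assume eq: "\<forall>j<n. key i z j = key i (P r) j"
        obtain j where j: "j < n" "\<delta> \<le> \<bar>N j (P r) - N j z\<bar>"
          using \<delta>(2)[OF PK[OF r] z(1) i(1) _ z(2)] i by (auto simp: P_def)
        have "\<bar>N j (P r) / \<delta> - N j z / \<delta>\<bar> < 1"
        proof -
          have "\<lfloor>N j z / \<delta> - real i / real (n + 1)\<rfloor> = \<lfloor>N j (P r) / \<delta> - real i / real (n + 1)\<rfloor>"
            using eq j(1) unfolding key_def by blast
          then show ?thesis
            using floor_correct[of "N j z / \<delta> - real i / real (n + 1)"]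
              floor_correct[of "N j (P r) / \<delta> - real i / real (n + 1)"] by linarith
        qed
        then have "\<bar>N j (P r) - N j z\<bar> < \<delta>"
          using \<delta>(1) by (simp add: diff_divide_distrib[symmetric] abs_divide)
        with j show False by simp
      qed
      then show "label r i = 0" by (auto simp: label_def)
    qed
    show "\<forall>r. (\<forall>i<M. r i \<le> p) \<longrightarrow> (\<forall>i<M. r i = p \<longrightarrow> label r i = 1)"
    proof (intro allI impI)
      fix r i assume r: "\<forall>i<M. r i \<le> p" and i: "i < M" "r i = p"
      have "P r i = 1" using i p by (simp add: P_def)
      then show "label r i = 1"
        using PK[OF r] by (auto simp: label_def)
    qed
  qed (use p in \<open>auto simp: label_def\<close>)
  \<comment> \<open>The shift is chosen for the corner \<open>q\<close> alone. In units of
    \<open>\<delta>\<close>, the information at the other corners of the small cube differs from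
    that at \<open>q\<close> by less than \<open>h\<close>, so the keys for this shift agree on all
    corners.\<close>
  from exists_shift_away_from_integers[of n "\<lambda>j. N j (P q) / \<delta>"]
  obtain i where "i \<le> n" and
    "\<forall>j<n. \<forall>a. 1 / (2 * real (n + 1)) \<le> \<bar>N j (P q) / \<delta> - real i / real (n + 1) - of_int a\<bar>"
    by (elim exE conjE)
  then have i: "i \<le> n"
    "\<And>j a. j < n \<Longrightarrow> h \<le> \<bar>N j (P q) / \<delta> - real i / real (n + 1) - of_int a\<bar>"
    unfolding h_def by blast+
  have qp: "\<forall>i<M. q i \<le> p" using q by auto
  have key: "key i (P r) j = key i (P q) j"
    if r: "\<forall>j<M. q j \<le> r j \<and> r j \<le> q j + 1" and j: "j < n" for r j
  proof -
    have rp: "\<forall>i<M. r i \<le> p"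
    proof (intro allI impI)
      fix k assume "k < M"
      with r q have "r k \<le> q k + 1" "q k < p" by simp_all
      then show "r k \<le> p" by simp
    qed
    have "\<bar>P r k - P q k\<bar> \<le> \<tau>" for k
    proof (cases "k < M")
      case True
      then have "\<bar>real (r k) - real (q k)\<bar> \<le> 1" using r by auto
      then have "\<bar>(real (r k) - real (q k)) / real p\<bar> \<le> 1 / real p"
        by (simp add: divide_right_mono)
      with True p(2) show ?thesis by (simp add: P_def diff_divide_distrib)
    qed (use \<tau>(1) in \<open>simp add: P_def\<close>)
    then have "dist (P r) (P q) < e j"
      using \<tau>(2)[of "P r" "P q"] \<eta>(2)[OF j] by auto
    then have "\<bar>N j (P r) - N j (P q)\<bar> < h * \<delta>"
      using e(2)[OF j PK[OF qp] PK[OF rp]] by simp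
    then have "\<bar>N j (P r) / \<delta> - N j (P q) / \<delta>\<bar> < h"
      using \<delta>(1) by (simp add: diff_divide_distrib[symmetric] abs_divide pos_divide_less_eq)
    then show ?thesis
      unfolding key_def by (intro floor_stable[where h = h] i(2)[OF j]) simp
  qed
  \<comment> \<open>Here \<open>n < M\<close> enters: the good shift is also a coordinate, and
    Kuhn's lemma gives two corners with different labels for it, although the label depends on the
    key alone.\<close>
  have "i < M" using i(1) \<open>n < M\<close> by simp
  with l obtain r s where rs: "\<forall>j<M. q j \<le> r j \<and> r j \<le> q j + 1" "\<forall>j<M. q j \<le> s j \<and> s j \<le> q j + 1"
    "label r i \<noteq> label s i" by blast
  then show False
    using key[OF rs(1)] key[OF rs(2)] by (auto simp: label_def split: if_splits)
qed

section \<open>Smooth functions and the weighted norm\<close>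

lemma cube_upd: "x \<in> cube d \<Longrightarrow> j \<in> {1..d} \<Longrightarrow> t \<in> {0..1} \<Longrightarrow> x(j := t) \<in> cube d"
  by (auto simp: cube_def PiE_iff extensional_def)

lemma iterated_deriv_Nil [simp]: "iterated_deriv d [] f = f"
  by (simp add: iterated_deriv_def)

lemma iterated_deriv_Cons: "iterated_deriv d (j # js) f = iterated_deriv d js (partial_deriv d j f)"
  by (simp add: iterated_deriv_def)

lemma iterated_deriv_append:
  "iterated_deriv d (js @ ks) f = iterated_deriv d ks (iterated_deriv d js f)"
  by (simp add: iterated_deriv_def)

lemma partial_deriv_eqI:
  assumes "x \<in> cube d" "j \<in> {1..d}"
    and "((\<lambda>t. f (x(j := t))) has_vector_derivative D) (at (x j) within {0..1})"
  shows "partial_deriv d j f x = D"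
proof -
  have "x j \<in> {0..1}" using assms(1,2) by (auto simp: cube_def PiE_iff)
  then show ?thesis
    using assms vector_derivative_within_closed_interval[of 0 1 "x j" "\<lambda>t. f (x(j := t))" D]
    by (simp add: partial_deriv_def)
qed

lemma smooth_on_cube_partial_deriv:
  "smooth_on_cube d f \<Longrightarrow> j \<in> {1..d} \<Longrightarrow> smooth_on_cube d (partial_deriv d j f)"
  unfolding smooth_on_cube_def iterated_deriv_Cons[symmetric] by simp

lemma smooth_on_cube_iterated_deriv:
  "smooth_on_cube d f \<Longrightarrow> js \<in> lists {1..d} \<Longrightarrow> smooth_on_cube d (iterated_deriv d js f)"
  unfolding smooth_on_cube_def iterated_deriv_append[symmetric] by simp

lemma smooth_on_cubeD:
  assumes "smooth_on_cube d f"
  shows "continuous_on (cube d) f"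
    and "j \<in> {1..d} \<Longrightarrow> x \<in> cube d \<Longrightarrow>
      ((\<lambda>t. f (x(j := t))) has_vector_derivative partial_deriv d j f x) (at (x j) within {0..1})"
proof -
  have *: "continuous_on (cube d) (iterated_deriv d [] f) \<and> (\<forall>j \<in> {1..d}. \<forall>x \<in> cube d.
      (\<lambda>t. iterated_deriv d [] f (x(j := t))) differentiable (at (x j) within {0..1}))"
    using assms unfolding smooth_on_cube_def by (rule bspec) simp
  then show "continuous_on (cube d) f" by simp
  assume "j \<in> {1..d}" "x \<in> cube d"
  with * have "(\<lambda>t. f (x(j := t))) differentiable (at (x j) within {0..1})" by simp
  with \<open>x \<in> cube d\<close> show "((\<lambda>t. f (x(j := t))) has_vector_derivative partial_deriv d j f x) (at (x j) within {0..1})"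
    by (simp add: vector_derivative_works partial_deriv_def)
qed

lemma smooth_on_cubeI:
  assumes "\<And>js. js \<in> lists {1..d} \<Longrightarrow> continuous_on (cube d) (iterated_deriv d js f)"
    and "\<And>js j x. js \<in> lists {1..d} \<Longrightarrow> j \<in> {1..d} \<Longrightarrow> x \<in> cube d \<Longrightarrow>
      \<exists>D. ((\<lambda>t. iterated_deriv d js f (x(j := t))) has_vector_derivative D) (at (x j) within {0..1})"
  shows "smooth_on_cube d f"
  unfolding smooth_on_cube_def
proof (intro ballI conjI assms(1))
  fix js j x assume "js \<in> lists {1..d}" "j \<in> {1..d}" "x \<in> cube d"
  from assms(2)[OF this] show "(\<lambda>t. iterated_deriv d js f (x(j := t))) differentiable (at (x j) within {0..1})"
    using differentiableI_vector by (elim exE)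
qed

lemma partial_deriv_linear:
  assumes f: "smooth_on_cube d f" and g: "smooth_on_cube d g" and j: "j \<in> {1..d}"
  shows "partial_deriv d j (\<lambda>x. a * f x + b * g x) =
    (\<lambda>x. a * partial_deriv d j f x + b * partial_deriv d j g x)"
proof
  fix x
  show "partial_deriv d j (\<lambda>x. a * f x + b * g x) x = a * partial_deriv d j f x + b * partial_deriv d j g x"
  proof (cases "x \<in> cube d")
    case True
    then show ?thesis
      by (intro partial_deriv_eqI j has_vector_derivative_add has_vector_derivative_mult_right
          smooth_on_cubeD(2)[OF f] smooth_on_cubeD(2)[OF g])
  qed (simp add: partial_deriv_def)
qed

lemma iterated_deriv_linear:
  assumes "smooth_on_cube d f" "smooth_on_cube d g" "js \<in> lists {1..d}"
  shows "iterated_deriv d js (\<lambda>x. a * f x + b * g x) =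
    (\<lambda>x. a * iterated_deriv d js f x + b * iterated_deriv d js g x)"
  using assms
proof (induction js arbitrary: f g)
  case (Cons j js)
  then have j: "j \<in> {1..d}" and js: "js \<in> lists {1..d}" by simp_all
  show ?case
    unfolding iterated_deriv_Cons partial_deriv_linear[OF Cons.prems(1,2) j]
    by (intro Cons.IH smooth_on_cube_partial_deriv Cons.prems(1,2) j js)
qed simp

lemma smooth_on_cube_linear:
  assumes f: "smooth_on_cube d f" and g: "smooth_on_cube d g"
  shows "smooth_on_cube d (\<lambda>x. a * f x + b * g x)"
proof (rule smooth_on_cubeI)
  fix js assume js: "js \<in> lists {1..d}"
  note smf = smooth_on_cubeD[OF smooth_on_cube_iterated_deriv[OF f js]]
  note smg = smooth_on_cubeD[OF smooth_on_cube_iterated_deriv[OF g js]]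
  show "continuous_on (cube d) (iterated_deriv d js (\<lambda>x. a * f x + b * g x))"
    unfolding iterated_deriv_linear[OF f g js]
    by (intro continuous_on_add continuous_on_mult continuous_on_const smf(1) smg(1))
  fix j x assume "j \<in> {1..d}" "x \<in> cube d"
  then show "\<exists>D. ((\<lambda>t. iterated_deriv d js (\<lambda>x. a * f x + b * g x) (x(j := t))) has_vector_derivative D)
      (at (x j) within {0..1})"
    unfolding iterated_deriv_linear[OF f g js]
    by (intro exI[of _ "a * partial_deriv d j (iterated_deriv d js f) x + b * partial_deriv d j (iterated_deriv d js g) x"]
        has_vector_derivative_add has_vector_derivative_mult_right smf(2) smg(2))
qed

text \<open>The list in \<open>multi_deriv\<close>, cut off after the coordinate \<open>m\<close> to
  allow induction over the coordinates.\<close>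

definition index_list :: "(nat \<Rightarrow> nat) \<Rightarrow> nat \<Rightarrow> nat list" where
  "index_list \<alpha> m = concat (map (\<lambda>j. replicate (\<alpha> j) j) [1..<m + 1])"

lemma multi_deriv_index_list: "multi_deriv d \<alpha> f = iterated_deriv d (index_list \<alpha> d) f"
  by (simp add: multi_deriv_def index_list_def)

lemma index_list_0 [simp]: "index_list \<alpha> 0 = []"
  by (simp add: index_list_def)

lemma index_list_Suc: "index_list \<alpha> (Suc m) = index_list \<alpha> m @ replicate (\<alpha> (Suc m)) (Suc m)"
  by (simp add: index_list_def)

lemma index_list_cong: "(\<And>j. j \<in> {1..m} \<Longrightarrow> \<alpha> j = \<beta> j) \<Longrightarrow> index_list \<alpha> m = index_list \<beta> m"
  by (induction m) (simp_all add: index_list_Suc)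

lemma index_list_in_lists: "m \<le> d \<Longrightarrow> index_list \<alpha> m \<in> lists {1..d}"
  by (induction m) (auto simp: index_list_Suc)

lemma multi_deriv_linear:
  assumes "smooth_on_cube d f" "smooth_on_cube d g"
  shows "multi_deriv d \<alpha> (\<lambda>x. a * f x + b * g x) =
    (\<lambda>x. a * multi_deriv d \<alpha> f x + b * multi_deriv d \<alpha> g x)"
  unfolding multi_deriv_index_list
  by (intro iterated_deriv_linear assms index_list_in_lists) simp

lemma continuous_on_multi_deriv:
  "smooth_on_cube d f \<Longrightarrow> continuous_on (cube d) (multi_deriv d \<alpha> f)"
  unfolding multi_deriv_index_list
  by (intro smooth_on_cubeD(1) smooth_on_cube_iterated_deriv index_list_in_lists) simp_all

section \<open>The weighted norm and its linear structure\<close>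

locale positive_weights =
  fixes \<gamma> :: "nat \<Rightarrow> nat \<Rightarrow> real" and d :: nat
  assumes pos: "\<And>j. j \<in> {1..d} \<Longrightarrow> \<gamma> d j > 0"
begin

lemma weight_pos: "weight \<gamma> d \<alpha> > 0"
  unfolding weight_def by (intro prod_pos zero_less_power pos)

lemma F_normD:
  assumes f: "smooth_on_cube d f" and le: "F_norm \<gamma> d f \<le> ereal c"
    and \<alpha>: "\<alpha> \<in> multi_indices d" and x: "x \<in> cube d"
  shows "\<bar>multi_deriv d \<alpha> f x\<bar> \<le> weight \<gamma> d \<alpha> * c"
proof -
  have "ereal (1 / weight \<gamma> d \<alpha>) * ereal \<bar>multi_deriv d \<alpha> f x\<bar> \<le>
      ereal (1 / weight \<gamma> d \<alpha>) * Linf_norm d (multi_deriv d \<alpha> f)"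
    using weight_pos[of \<alpha>]
    by (intro ereal_mult_left_mono Linf_norm_ge continuous_on_multi_deriv f x) simp
  also have "\<dots> \<le> F_norm \<gamma> d f"
    unfolding F_norm_def by (rule SUP_upper[OF \<alpha>])
  also have "\<dots> \<le> ereal c" by (rule le)
  finally have "1 / weight \<gamma> d \<alpha> * \<bar>multi_deriv d \<alpha> f x\<bar> \<le> c" by simp
  then show ?thesis
    using weight_pos[of \<alpha>] by (simp add: pos_divide_le_eq mult.commute)
qed

lemma F_normI:
  assumes f: "smooth_on_cube d f"
    and le: "\<And>\<alpha> x. x \<in> cube d \<Longrightarrow> \<bar>multi_deriv d \<alpha> f x\<bar> \<le> weight \<gamma> d \<alpha> * c"
  shows "F_norm \<gamma> d f \<le> ereal c"
  unfolding F_norm_def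
proof (rule SUP_least)
  fix \<alpha>
  have "ereal (1 / weight \<gamma> d \<alpha>) * Linf_norm d (multi_deriv d \<alpha> f) \<le>
      ereal (1 / weight \<gamma> d \<alpha>) * ereal (weight \<gamma> d \<alpha> * c)"
    using weight_pos[of \<alpha>]
    by (intro ereal_mult_left_mono Linf_norm_le continuous_on_multi_deriv f le) simp_all
  also have "\<dots> = ereal c" using weight_pos[of \<alpha>] by simp
  finally show "ereal (1 / weight \<gamma> d \<alpha>) * Linf_norm d (multi_deriv d \<alpha> f) \<le> ereal c" .
qed

lemma F_finite_norm:
  assumes "f \<in> F \<gamma> d"
  shows "\<exists>c. F_norm \<gamma> d f \<le> ereal c"
  using assms by (cases "F_norm \<gamma> d f") (auto simp: F_def)

lemma F_norm_linear:
  assumes f: "f \<in> F \<gamma> d" and g: "g \<in> F \<gamma> d"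
    and c: "F_norm \<gamma> d f \<le> ereal cf" "F_norm \<gamma> d g \<le> ereal cg"
  shows "F_norm \<gamma> d (\<lambda>x. a * f x + b * g x) \<le> ereal (\<bar>a\<bar> * cf + \<bar>b\<bar> * cg)"
proof -
  have sm: "smooth_on_cube d f" "smooth_on_cube d g"
    using f g by (simp_all add: F_def)
  show ?thesis
  proof (rule F_normI)
    fix \<alpha> :: "nat \<Rightarrow> nat" and x assume x: "x \<in> cube d"
    \<comment> \<open>\<open>F_normI\<close> asks for all \<open>\<alpha>\<close>, while
      \<open>F_normD\<close> speaks of extensional ones; restricting \<open>\<alpha>\<close> changes
      neither the derivative nor the weight.\<close>
    let ?\<beta> = "restrict \<alpha> {1..d} :: nat \<Rightarrow> nat"
    have \<beta>: "?\<beta> \<in> multi_indices d" by (simp add: multi_indices_def)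
    have "index_list \<alpha> d = index_list ?\<beta> d"
      by (rule index_list_cong) simp
    then have eq: "multi_deriv d \<alpha> h = multi_deriv d ?\<beta> h" "weight \<gamma> d \<alpha> = weight \<gamma> d ?\<beta>" for h
      by (simp_all add: multi_deriv_index_list weight_def)
    have "\<bar>a * multi_deriv d ?\<beta> f x + b * multi_deriv d ?\<beta> g x\<bar> \<le>
        \<bar>a\<bar> * \<bar>multi_deriv d ?\<beta> f x\<bar> + \<bar>b\<bar> * \<bar>multi_deriv d ?\<beta> g x\<bar>"
      unfolding abs_mult[symmetric] by (rule abs_triangle_ineq)
    also have "\<dots> \<le> \<bar>a\<bar> * (weight \<gamma> d ?\<beta> * cf) + \<bar>b\<bar> * (weight \<gamma> d ?\<beta> * cg)"
      by (intro add_mono mult_left_mono F_normD sm c \<beta> x) simp_all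
    also have "\<dots> = weight \<gamma> d ?\<beta> * (\<bar>a\<bar> * cf + \<bar>b\<bar> * cg)" by (simp add: algebra_simps)
    finally show "\<bar>multi_deriv d \<alpha> (\<lambda>x. a * f x + b * g x) x\<bar> \<le> weight \<gamma> d \<alpha> * (\<bar>a\<bar> * cf + \<bar>b\<bar> * cg)"
      by (simp add: multi_deriv_linear[OF sm] eq)
  qed (rule smooth_on_cube_linear[OF sm])
qed

lemma F_linear:
  assumes f: "f \<in> F \<gamma> d" and g: "g \<in> F \<gamma> d"
  shows "(\<lambda>x. a * f x + b * g x) \<in> F \<gamma> d"
proof -
  obtain cf cg where "F_norm \<gamma> d f \<le> ereal cf" "F_norm \<gamma> d g \<le> ereal cg"
    using F_finite_norm[OF f] F_finite_norm[OF g] by (elim exE)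
  from F_norm_linear[OF f g this, of a b] show ?thesis
    using f g smooth_on_cube_linear[of d f g a b] by (auto simp: F_def intro: le_less_trans)
qed

lemma F_scale: "f \<in> F \<gamma> d \<Longrightarrow> (\<lambda>x. a * f x) \<in> F \<gamma> d"
  using F_linear[of f f a 0] by simp

lemma continuous_linear_functional_linear:
  assumes L: "continuous_linear_functional \<gamma> d L" and f: "f \<in> F \<gamma> d" and g: "g \<in> F \<gamma> d"
  shows "L (\<lambda>x. a * f x + b * g x) = a * L f + b * L g"
  using L f g F_scale[OF f, of a] F_scale[OF g, of b] by (simp add: continuous_linear_functional_def)

end

section \<open>Multiaffine functions of block means\<close>

text \<open>The multilinear interpolant on \<open>[0,1]^n\<close> with the value \<open>c S\<close>
  at the vertex that is the indicator of \<open>S\<close>; the recursion splits off the last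
  variable.\<close>

primrec multiaffine :: "nat \<Rightarrow> (nat set \<Rightarrow> real) \<Rightarrow> (nat \<Rightarrow> real) \<Rightarrow> real" where
  "multiaffine 0 c y = c {}"
| "multiaffine (Suc n) c y =
     (1 - y n) * multiaffine n c y + y n * multiaffine n (\<lambda>S. c (insert n S)) y"

lemma multiaffine_cong:
  assumes "\<And>S. S \<subseteq> {..<n} \<Longrightarrow> c S = c' S" and "\<And>b. b < n \<Longrightarrow> y b = y' b"
  shows "multiaffine n c y = multiaffine n c' y'"
  using assms
proof (induction n arbitrary: c c')
  case (Suc n)
  have "multiaffine n c y = multiaffine n c' y'"
    by (rule Suc.IH) (auto intro!: Suc.prems)
  moreover have "multiaffine n (\<lambda>S. c (insert n S)) y = multiaffine n (\<lambda>S. c' (insert n S)) y'"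
    by (rule Suc.IH) (auto intro!: Suc.prems)
  ultimately show ?case
    using Suc.prems(2)[of n] by simp
qed simp

lemma multiaffine_linear:
  "multiaffine n (\<lambda>S. a * c S + b * c' S) y = a * multiaffine n c y + b * multiaffine n c' y"
  by (induction n arbitrary: c c') (simp_all add: algebra_simps)

text \<open>Each step of the recursion is a convex combination.\<close>

lemma abs_multiaffine_le:
  assumes "\<And>S. S \<subseteq> {..<n} \<Longrightarrow> \<bar>c S\<bar> \<le> K" and "\<And>b. b < n \<Longrightarrow> y b \<in> {0..1}"
  shows "\<bar>multiaffine n c y\<bar> \<le> K"
  using assms
proof (induction n arbitrary: c)
  case (Suc n)
  have 1: "\<bar>multiaffine n c y\<bar> \<le> K"
    by (rule Suc.IH) (use Suc.prems in \<open>auto simp: subset_iff less_Suc_eq\<close>)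
  have 2: "\<bar>multiaffine n (\<lambda>S. c (insert n S)) y\<bar> \<le> K"
    by (rule Suc.IH) (use Suc.prems in \<open>auto simp: subset_iff less_Suc_eq\<close>)
  have y: "0 \<le> y n" "0 \<le> 1 - y n"
    using Suc.prems(2)[of n] by simp_all
  have "\<bar>multiaffine (Suc n) c y\<bar> \<le> (1 - y n) * \<bar>multiaffine n c y\<bar> + y n * \<bar>multiaffine n (\<lambda>S. c (insert n S)) y\<bar>"
    using y by (simp add: abs_mult order.trans[OF abs_triangle_ineq])
  also have "\<dots> \<le> (1 - y n) * K + y n * K"
    by (intro add_mono mult_left_mono 1 2 y)
  finally show ?case by (simp add: algebra_simps)
qed simp

lemma multiaffine_vertex:
  "multiaffine n c (\<lambda>b. if b \<in> S then 1 else 0) = c (S \<inter> {..<n})"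
proof (induction n arbitrary: c)
  case (Suc n)
  then show ?case
    by (cases "n \<in> S") (simp_all add: lessThan_Suc Int_insert_right)
qed simp

text \<open>The function is affine in the variable \<open>b\<close>. Its slope is written with
  \<open>S - {b}\<close> instead of \<open>S\<close>, so that the coefficients do not depend on
  whether \<open>b\<close> belongs to \<open>S\<close>. The slope is then a multiaffine function of
  the same variables, constant in \<open>y b\<close>, and differencing can be iterated on the
  coefficients.\<close>

lemma multiaffine_upd:
  assumes "b < n"
  shows "multiaffine n c (y(b := y b + u)) =
    multiaffine n c y + u * multiaffine n (\<lambda>S. c (insert b S) - c (S - {b})) y"
  using assms
proof (induction n arbitrary: c)
  case (Suc n)
  show ?case
  proof (cases "b = n")
    case True
    have *: "multiaffine n c' (y(n := v)) = multiaffine n c' y" for c' v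
      by (rule multiaffine_cong) auto
    have "multiaffine n (\<lambda>S. c (insert n S) - c (S - {n})) y = multiaffine n (\<lambda>S. 1 * c (insert n S) + (-1) * c S) y"
      by (rule multiaffine_cong) (auto intro!: arg_cong[where f = c])
    moreover have "multiaffine n (\<lambda>S. c (insert n (insert n S)) - c (insert n S - {n})) y =
        multiaffine n (\<lambda>S. 1 * c (insert n S) + (-1) * c S) y"
      by (rule multiaffine_cong) (auto intro!: arg_cong[where f = c])
    ultimately have e2: "multiaffine (Suc n) (\<lambda>S. c (insert n S) - c (S - {n})) y =
        multiaffine n (\<lambda>S. c (insert n S)) y - multiaffine n c y"
      by (simp only: multiaffine_linear multiaffine.simps) (simp add: algebra_simps)
    have e1: "multiaffine (Suc n) c (y(n := y n + u)) =
        (1 - (y n + u)) * multiaffine n c y + (y n + u) * multiaffine n (\<lambda>S. c (insert n S)) y"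
      by (simp only: multiaffine.simps * fun_upd_same)
    show ?thesis
      unfolding True e1 e2 by (simp add: algebra_simps)
  next
    case False
    with Suc.prems have b: "b < n" by simp
    have "insert n S - {b} = insert n (S - {b})" for S
      using False by auto
    moreover have "(y(b := y b + u)) n = y n"
      using False by simp
    ultimately show ?thesis
      unfolding multiaffine.simps Suc.IH[OF b] by (simp only: insert_commute[of b n]) (simp add: algebra_simps)
  qed
qed simp

lemma continuous_on_multiaffine:
  fixes Y :: "'a::topological_space \<Rightarrow> nat \<Rightarrow> real"
  assumes "\<And>b. b < n \<Longrightarrow> continuous_on K (\<lambda>x. Y x b)"
  shows "continuous_on K (\<lambda>x. multiaffine n c (Y x))"
  using assms by (induction n arbitrary: c) (auto intro!: continuous_intros)

text \<open>The coordinates \<open>b * m + 1, \<dots>, b * m + m\<close> form the block with number \<open>b\<close>.\<close>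

definition block_mean :: "nat \<Rightarrow> (nat \<Rightarrow> real) \<Rightarrow> nat \<Rightarrow> real" where
  "block_mean m x b = (\<Sum>i<m. x (b * m + i + 1)) / real m"

definition block_fun :: "nat \<Rightarrow> nat \<Rightarrow> nat \<Rightarrow> (nat set \<Rightarrow> real) \<Rightarrow> cube_fun" where
  "block_fun d m s c = (\<lambda>x. if x \<in> cube d then multiaffine s c (block_mean m x) else 0)"

text \<open>The coefficients of the partial derivative in coordinate \<open>j\<close>. Since
  coordinates count from 1, \<open>(j - 1) div m\<close> is the block of \<open>j\<close>; the
  divisor \<open>real m\<close> is the chain rule for the block mean; coordinates beyond the
  \<open>s\<close> blocks have derivative 0.\<close>

definition block_diff :: "nat \<Rightarrow> nat \<Rightarrow> nat \<Rightarrow> (nat set \<Rightarrow> real) \<Rightarrow> nat set \<Rightarrow> real" where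
  "block_diff m s j c = (\<lambda>S. if (j - 1) div m < s
     then (c (insert ((j - 1) div m) S) - c (S - {(j - 1) div m})) / real m else 0)"

locale blocks =
  fixes m s d :: nat
  assumes m: "m > 0" and smd: "s * m \<le> d"
begin

lemma block_index: "b < s \<Longrightarrow> i < m \<Longrightarrow> b * m + i + 1 \<in> {1..d}"
proof -
  assume "b < s" "i < m"
  then have "b * m + m \<le> s * m"
    by (metis Suc_leI add.commute mult_Suc mult_le_mono1)
  with \<open>i < m\<close> smd show ?thesis by simp
qed

lemma block_mean_in_unit:
  assumes "x \<in> cube d" "b < s"
  shows "block_mean m x b \<in> {0..1}"
proof -
  have x: "x (b * m + i + 1) \<in> {0..1}" if "i < m" for i
    using assms(1) block_index[OF assms(2) that] by (auto simp: cube_def PiE_iff)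
  have "(\<Sum>i<m. x (b * m + i + 1)) \<ge> 0"
    by (rule sum_nonneg) (use x in auto)
  moreover have "(\<Sum>i<m. x (b * m + i + 1)) \<le> (\<Sum>i<m. 1)"
    by (rule sum_mono) (use x in auto)
  ultimately show ?thesis
    using m by (simp add: block_mean_def)
qed

lemma block_mean_upd:
  assumes "j \<ge> 1"
  shows "block_mean m (x(j := t)) =
    (block_mean m x)((j - 1) div m := block_mean m x ((j - 1) div m) + (t - x j) / real m)"
proof
  fix b
  define r where "r = (j - 1) mod m"
  have j: "j = (j - 1) div m * m + r + 1"
    using assms div_mult_mod_eq[of "j - 1" m] unfolding r_def by linarith
  show "block_mean m (x(j := t)) b =
    ((block_mean m x)((j - 1) div m := block_mean m x ((j - 1) div m) + (t - x j) / real m)) b"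
  proof (cases "b = (j - 1) div m")
    case True
    have "j = b * m + r + 1"
      unfolding True by (rule j)
    then have iff: "b * m + i + 1 = j \<longleftrightarrow> i = r" for i
      by simp
    have "r < m" using m by (simp add: r_def)
    have "(\<Sum>i<m. (x(j := t)) (b * m + i + 1)) = (\<Sum>i<m. x (b * m + i + 1) + (if i = r then t - x j else 0))"
      by (rule sum.cong) (auto simp: iff[symmetric])
    also have "\<dots> = (\<Sum>i<m. x (b * m + i + 1)) + (t - x j)"
      using \<open>r < m\<close> by (simp add: sum.distrib)
    finally show ?thesis
      using True by (simp add: block_mean_def add_divide_distrib)
  next
    case False
    have "b * m + i + 1 \<noteq> j" if "i < m" for i
    proof
      assume "b * m + i + 1 = j"
      then have "(j - 1) div m = (b * m + i) div m" by auto
      also have "\<dots> = b" using that by simp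
      finally show False using False by simp
    qed
    then show ?thesis
      using False by (simp add: block_mean_def)
  qed
qed

text \<open>An exact identity: the function is affine in each coordinate, with a slope of the same
  kind. Derivatives of all orders, one-sided ones included, are read off from it.\<close>

lemma block_fun_upd:
  assumes x: "x \<in> cube d" and j: "j \<in> {1..d}" and t: "t \<in> {0..1}"
  shows "block_fun d m s c (x(j := t)) = block_fun d m s c x + (t - x j) * block_fun d m s (block_diff m s j c) x"
proof -
  let ?b = "(j - 1) div m"
  have j1: "j \<ge> 1" using j by simp
  have eq: "block_fun d m s c (x(j := t)) =
      multiaffine s c ((block_mean m x)(?b := block_mean m x ?b + (t - x j) / real m))"
    by (simp add: block_fun_def cube_upd[OF x j t] block_mean_upd[OF j1])
  show ?thesis
  proof (cases "?b < s")
    case True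
    \<comment> \<open>The summand \<open>0 * 0\<close> only gives the coefficients the shape that
      \<open>multiaffine_linear\<close> rewrites.\<close>
    have "multiaffine s (block_diff m s j c) (block_mean m x) =
        multiaffine s (\<lambda>S. (1 / real m) * (c (insert ?b S) - c (S - {?b})) + 0 * 0) (block_mean m x)"
      using True by (intro multiaffine_cong) (simp_all add: block_diff_def)
    then show ?thesis
      unfolding eq multiaffine_upd[OF True] multiaffine_linear by (simp add: block_fun_def x)
  next
    case False
    have "multiaffine s (block_diff m s j c) (block_mean m x) = multiaffine s (\<lambda>S. 0 * 0 + 0 * 0) (block_mean m x)"
      using False by (intro multiaffine_cong) (simp_all add: block_diff_def)
    moreover have "multiaffine s c ((block_mean m x)(?b := block_mean m x ?b + (t - x j) / real m)) =
        multiaffine s c (block_mean m x)"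
      by (rule multiaffine_cong) (use False in auto)
    ultimately show ?thesis
      unfolding eq multiaffine_linear by (simp add: block_fun_def x)
  qed
qed

lemma block_fun_has_derivative:
  assumes x: "x \<in> cube d" and j: "j \<in> {1..d}"
  shows "((\<lambda>t. block_fun d m s c (x(j := t))) has_vector_derivative block_fun d m s (block_diff m s j c) x)
    (at (x j) within {0..1})"
proof (rule has_vector_derivative_transform)
  show "x j \<in> {0..1}"
    using x j by (auto simp: cube_def PiE_iff)
  show "((\<lambda>t. block_fun d m s c x + (t - x j) * block_fun d m s (block_diff m s j c) x)
      has_vector_derivative block_fun d m s (block_diff m s j c) x) (at (x j) within {0..1})"
    by (auto intro!: derivative_eq_intros simp: has_real_derivative_iff_has_vector_derivative[symmetric])
qed (rule block_fun_upd[OF x j])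

lemma partial_deriv_block_fun:
  assumes "j \<in> {1..d}"
  shows "partial_deriv d j (block_fun d m s c) = block_fun d m s (block_diff m s j c)"
proof
  fix x
  show "partial_deriv d j (block_fun d m s c) x = block_fun d m s (block_diff m s j c) x"
  proof (cases "x \<in> cube d")
    case True
    then show ?thesis
      by (intro partial_deriv_eqI block_fun_has_derivative assms)
  qed (simp add: partial_deriv_def block_fun_def)
qed

lemma iterated_deriv_block_fun:
  assumes "js \<in> lists {1..d}"
  shows "iterated_deriv d js (block_fun d m s c) = block_fun d m s (fold (block_diff m s) js c)"
  using assms
proof (induction js arbitrary: c rule: list.induct)
  case (Cons j js)
  then have j: "j \<in> {1..d}" and js: "js \<in> lists {1..d}" by simp_all
  show ?case
    unfolding iterated_deriv_Cons partial_deriv_block_fun[OF j] Cons.IH[OF js] by simp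
qed simp

lemma continuous_on_block_fun: "continuous_on (cube d) (block_fun d m s c)"
proof -
  have "continuous_on (cube d) (\<lambda>x. multiaffine s c (block_mean m x))"
    unfolding block_mean_def[abs_def]
    by (intro continuous_on_multiaffine continuous_intros continuous_on_subset[OF continuous_on_product_coordinates])
      (use m in auto)
  then show ?thesis
    by (rule continuous_on_eq) (simp add: block_fun_def)
qed

lemma smooth_on_cube_block_fun: "smooth_on_cube d (block_fun d m s c)"
proof (rule smooth_on_cubeI)
  fix js assume js: "js \<in> lists {1..d}"
  show "continuous_on (cube d) (iterated_deriv d js (block_fun d m s c))"
    unfolding iterated_deriv_block_fun[OF js] by (rule continuous_on_block_fun)
  fix j x assume "j \<in> {1..d}" "x \<in> cube d"
  then show "\<exists>D. ((\<lambda>t. iterated_deriv d js (block_fun d m s c) (x(j := t))) has_vector_derivative D)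
      (at (x j) within {0..1})"
    unfolding iterated_deriv_block_fun[OF js] by (blast intro: block_fun_has_derivative)
qed

lemma abs_block_fun_le:
  assumes "\<And>S. S \<subseteq> {..<s} \<Longrightarrow> \<bar>c S\<bar> \<le> K" "x \<in> cube d"
  shows "\<bar>block_fun d m s c x\<bar> \<le> K"
  using assms by (simp add: block_fun_def) (intro abs_multiaffine_le block_mean_in_unit; simp)

end

section \<open>Block functions in the unit ball of the weighted space\<close>

locale weighted_blocks = blocks m s d + positive_weights \<gamma> d
  for \<gamma> :: "nat \<Rightarrow> nat \<Rightarrow> real" and m s d :: nat +
  assumes large: "\<And>j. 1 \<le> j \<Longrightarrow> j \<le> s * m \<Longrightarrow> 2 / real m \<le> \<gamma> d j"
begin

text \<open>The origin of \<open>2 / real m\<close>: two coefficients differ by at most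
  \<open>2 * K\<close>, and a block mean has slope \<open>1 / real m\<close> in each of its
  coordinates. Outside the blocks the difference is 0.\<close>

lemma abs_block_diff_le:
  assumes c: "\<And>S. S \<subseteq> {..<s} \<Longrightarrow> \<bar>c S\<bar> \<le> K" and j: "j \<in> {1..d}" and S: "S \<subseteq> {..<s}"
  shows "\<bar>block_diff m s j c S\<bar> \<le> \<gamma> d j * K"
proof -
  have K: "0 \<le> K" using c[of "{}"] by auto
  let ?b = "(j - 1) div m"
  show ?thesis
  proof (cases "?b < s")
    case True
    have "\<bar>c (insert ?b S)\<bar> \<le> K" "\<bar>c (S - {?b})\<bar> \<le> K"
      by (intro c; use S True in auto)+
    then have "\<bar>c (insert ?b S) - c (S - {?b})\<bar> \<le> 2 * K" by linarith
    then have "\<bar>block_diff m s j c S\<bar> \<le> 2 * K / real m"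
      using True m by (simp add: block_diff_def abs_divide divide_right_mono)
    also have "\<dots> = 2 / real m * K" by simp
    also have "\<dots> \<le> \<gamma> d j * K"
    proof (intro mult_right_mono large K)
      have "j - 1 < s * m" using True m by (simp add: div_less_iff_less_mult)
      then show "j \<le> s * m" by simp
    qed (use j in simp)
    finally show ?thesis .
  next
    case False
    then show ?thesis using pos[OF j] K by (simp add: block_diff_def)
  qed
qed

lemma abs_fold_block_diff_le:
  assumes "\<And>S. S \<subseteq> {..<s} \<Longrightarrow> \<bar>c S\<bar> \<le> K" "js \<in> lists {1..d}" "S \<subseteq> {..<s}"
  shows "\<bar>fold (block_diff m s) js c S\<bar> \<le> prod_list (map (\<gamma> d) js) * K"
  using assms(1,2)
proof (induction js arbitrary: c K)
  case Nil
  then show ?case using assms(3) by simp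
next
  case (Cons j js)
  then have j: "j \<in> {1..d}" and js: "js \<in> lists {1..d}" by simp_all
  have "\<bar>fold (block_diff m s) js (block_diff m s j c) S\<bar> \<le> prod_list (map (\<gamma> d) js) * (\<gamma> d j * K)"
    by (intro Cons.IH js abs_block_diff_le Cons.prems(1) j)
  then show ?case by (simp add: mult_ac)
qed

lemma prod_list_index_list: "prod_list (map (\<gamma> d) (index_list \<alpha> n)) = (\<Prod>j=1..n. \<gamma> d j ^ \<alpha> j)"
  by (induction n) (simp_all add: index_list_Suc)

lemma F_norm_block_fun_le:
  assumes "\<And>S. S \<subseteq> {..<s} \<Longrightarrow> \<bar>c S\<bar> \<le> K"
  shows "F_norm \<gamma> d (block_fun d m s c) \<le> ereal K"
proof (rule F_normI)
  fix \<alpha> x assume x: "x \<in> cube d"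
  show "\<bar>multi_deriv d \<alpha> (block_fun d m s c) x\<bar> \<le> weight \<gamma> d \<alpha> * K"
    unfolding multi_deriv_index_list iterated_deriv_block_fun[OF index_list_in_lists[OF order.refl]]
      weight_def prod_list_index_list[symmetric]
    by (intro abs_block_fun_le abs_fold_block_diff_le assms index_list_in_lists x order.refl)
qed (rule smooth_on_cube_block_fun)

lemma block_fun_in_F: "block_fun d m s c \<in> F \<gamma> d"
proof -
  let ?K = "Max ((\<lambda>S. \<bar>c S\<bar>) ` Pow {..<s})"
  have "F_norm \<gamma> d (block_fun d m s c) \<le> ereal ?K"
    by (rule F_norm_block_fun_le) auto
  then show ?thesis
    using smooth_on_cube_block_fun by (auto simp: F_def block_fun_def intro: le_less_trans)
qed

end

section \<open>Lower bound\<close>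

context weighted_blocks
begin

text \<open>On block functions the functional is a continuous function of finitely many
  coefficients, because the norm of a difference is at most the largest difference of
  coefficients.\<close>

lemma continuous_on_functional_block_fun:
  assumes L: "continuous_functional \<gamma> d L"
    and c: "\<And>S. S \<subseteq> {..<s} \<Longrightarrow> continuous_on K (\<lambda>x. c x S)"
  shows "continuous_on K (\<lambda>x. L (block_fun d m s (c x)))"
  unfolding continuous_on_def
proof (intro ballI tendstoI)
  fix x0 and e :: real assume x0: "x0 \<in> K" and "0 < e"
  note inF = block_fun_in_F
  from L inF[of "c x0"] \<open>0 < e\<close> obtain \<delta> where "\<delta> > 0" and
    \<delta>: "\<forall>g\<in>F \<gamma> d. F_norm \<gamma> d (\<lambda>x. g x - block_fun d m s (c x0) x) < ereal \<delta> \<longrightarrow> \<bar>L g - L (block_fun d m s (c x0))\<bar> < e"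
    unfolding continuous_functional_def by blast
  have "\<forall>\<^sub>F x in at x0 within K. \<forall>S\<in>Pow {..<s}. dist (c x S) (c x0 S) < \<delta> / 2"
  proof (rule eventually_ball_finite)
    show "\<forall>S\<in>Pow {..<s}. \<forall>\<^sub>F x in at x0 within K. dist (c x S) (c x0 S) < \<delta> / 2"
    proof
      fix S assume "S \<in> Pow {..<s}"
      then have "((\<lambda>x. c x S) \<longlongrightarrow> c x0 S) (at x0 within K)"
        using c x0 by (simp add: continuous_on_def)
      then show "\<forall>\<^sub>F x in at x0 within K. dist (c x S) (c x0 S) < \<delta> / 2"
        by (rule tendstoD) (use \<open>\<delta> > 0\<close> in simp)
    qed
  qed simp
  then show "\<forall>\<^sub>F x in at x0 within K. dist (L (block_fun d m s (c x))) (L (block_fun d m s (c x0))) < e"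
  proof (rule eventually_mono)
    fix x assume x: "\<forall>S\<in>Pow {..<s}. dist (c x S) (c x0 S) < \<delta> / 2"
    have "(\<lambda>z. block_fun d m s (c x) z - block_fun d m s (c x0) z) =
        block_fun d m s (\<lambda>S. 1 * c x S + (-1) * c x0 S)"
      unfolding block_fun_def multiaffine_linear by auto
    moreover have "F_norm \<gamma> d (block_fun d m s (\<lambda>S. 1 * c x S + (-1) * c x0 S)) \<le> ereal (\<delta> / 2)"
      by (rule F_norm_block_fun_le)
        (use x in \<open>auto simp: dist_real_def intro: less_imp_le\<close>)
    ultimately have "F_norm \<gamma> d (\<lambda>z. block_fun d m s (c x) z - block_fun d m s (c x0) z) < ereal \<delta>"
      using \<open>\<delta> > 0\<close> by (auto intro: le_less_trans)
    then show "dist (L (block_fun d m s (c x))) (L (block_fun d m s (c x0))) < e"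
      using \<delta> inF by (simp add: dist_real_def)
  qed
qed

text \<open>The point is 1 on the blocks in \<open>S\<close> and 0 elsewhere, so the block means
  form a vertex. It is the same point for all \<open>c\<close>, hence serves both functions of a
  pair at once.\<close>

lemma block_fun_vertex:
  assumes "S \<subseteq> {..<s}"
  shows "\<exists>x\<in>cube d. \<forall>c. block_fun d m s c x = c S"
proof -
  define x :: "nat \<Rightarrow> real" where "x = restrict (\<lambda>j. if (j - 1) div m \<in> S then 1 else 0) {1..d}"
  have x: "x \<in> cube d"
    by (auto simp: x_def cube_def)
  have "block_mean m x b = (if b \<in> S then 1 else 0)" if b: "b < s" for b
  proof -
    have "x (b * m + i + 1) = (if b \<in> S then 1 else 0)" if i: "i < m" for i
    proof -
      have "b * m + i + 1 \<in> {1..d}" by (rule block_index[OF b i])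
      moreover have "(b * m + i + 1 - 1) div m = b" using i by simp
      ultimately show ?thesis unfolding x_def by simp
    qed
    then have "(\<Sum>i<m. x (b * m + i + 1)) = (\<Sum>i<m. if b \<in> S then 1 else 0)"
      by (intro sum.cong) auto
    then show ?thesis using m by (simp add: block_mean_def)
  qed
  then have "multiaffine s c (block_mean m x) = multiaffine s c (\<lambda>b. if b \<in> S then 1 else 0)" for c
    by (intro multiaffine_cong) auto
  moreover have "S \<inter> {..<s} = S" using assms by auto
  ultimately have "\<forall>c. block_fun d m s c x = c S"
    by (simp add: block_fun_def x multiaffine_vertex)
  with x show ?thesis by blast
qed

lemma indistinguishable_pair:
  fixes n :: nat
  assumes n: "n < 2 ^ s" and L: "\<forall>j<n. continuous_functional \<gamma> d (L j)"
  shows "\<exists>u\<in>F \<gamma> d. \<exists>v\<in>F \<gamma> d. F_norm \<gamma> d u \<le> 1 \<and> F_norm \<gamma> d v \<le> 1 \<and> (\<forall>j<n. L j u = L j v) \<and>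
    (\<exists>x\<in>cube d. \<bar>u x - v x\<bar> = 2)"
proof -
  obtain h where h: "bij_betw h (Pow {..<s}) {0..<card (Pow {..<s})}"
    using ex_bij_betw_finite_nat[of "Pow {..<s}"] by auto
  then have h: "bij_betw h (Pow {..<s}) {..<2 ^ s}"
    by (simp add: card_Pow atLeast0LessThan)
  let ?K = "{..<2 ^ s} \<rightarrow>\<^sub>E {0..1::real}"
  \<comment> \<open>Rescales the unit cube of dimension \<open>2 ^ s\<close> to coefficients in
    \<open>[-1,1]\<close>: opposite faces become coefficients -1 and 1 at a common vertex, which is
    the source of the distance 2.\<close>
  let ?u = "\<lambda>x. block_fun d m s (\<lambda>S. 2 * x (h S) - 1)"
  have hS: "h S < 2 ^ s" if "S \<subseteq> {..<s}" for S
    using bij_betwE[OF h] that by auto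
  have cont: "\<forall>j<n. continuous_on ?K (\<lambda>x. L j (?u x))"
  proof (intro allI impI)
    fix j assume "j < n"
    with L have "continuous_functional \<gamma> d (L j)" by blast
    then show "continuous_on ?K (\<lambda>x. L j (?u x))"
      by (rule continuous_on_functional_block_fun)
        (intro continuous_intros continuous_on_subset[OF continuous_on_product_coordinates], auto)
  qed
  obtain x z i where xz: "x \<in> ?K" "z \<in> ?K" and i: "i < 2 ^ s" "x i = 0" "z i = 1"
    and eq: "\<forall>j<n. L j (?u x) = L j (?u z)"
    using opposite_faces_share_fibre[of n "2 ^ s" "\<lambda>j x. L j (?u x)", OF cont n]
    by (elim bexE exE conjE)
  have norm: "F_norm \<gamma> d (?u y) \<le> 1" if "y \<in> ?K" for y
    unfolding one_ereal_def
  proof (rule F_norm_block_fun_le)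
    fix S assume "S \<subseteq> {..<s}"
    then have "y (h S) \<in> {0..1}" using that hS by (auto simp: PiE_iff)
    then show "\<bar>2 * y (h S) - 1\<bar> \<le> 1" by auto
  qed
  have "i \<in> h ` Pow {..<s}"
    using h i(1) by (simp add: bij_betw_def)
  then obtain S where S: "S \<subseteq> {..<s}" "h S = i"
    by blast
  obtain p where "p \<in> cube d" and p: "\<forall>c. block_fun d m s c p = c S"
    using block_fun_vertex[OF S(1)] by (elim bexE)
  have "\<bar>?u x p - ?u z p\<bar> = 2"
    unfolding p[rule_format] S(2) i by simp
  with \<open>p \<in> cube d\<close> have "\<exists>p\<in>cube d. \<bar>?u x p - ?u z p\<bar> = 2" by blast
  with eq norm[OF xz(1)] norm[OF xz(2)] show ?thesis
    using block_fun_in_F by blast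
qed

lemma adaptive_information_zeros:
  assumes "\<And>k. k < n \<Longrightarrow> L (replicate k 0) f = 0"
  shows "adaptive_information L f n = replicate n 0"
  using assms by (induction n) (simp_all add: Let_def replicate_append_same)

lemma unit_ball_collision:
  fixes n :: nat
  assumes n: "n < 2 ^ s"
    and A: "A \<in> linear_algorithms \<gamma> d n \<or> A \<in> nonlinear_algorithms \<gamma> d n"
  shows "\<exists>u\<in>F \<gamma> d. \<exists>v\<in>F \<gamma> d. F_norm \<gamma> d u \<le> 1 \<and> F_norm \<gamma> d v \<le> 1 \<and> A u = A v \<and>
    (\<exists>x\<in>cube d. \<bar>u x - v x\<bar> = 2)"
proof -
  consider (lin) "A \<in> linear_algorithms \<gamma> d n"
    | (nonad) "A \<in> nonadaptive_continuous_algorithms \<gamma> d n"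
    | (adap) "A \<in> adaptive_linear_algorithms \<gamma> d n"
    using A by (auto simp: nonlinear_algorithms_def)
  then show ?thesis
  proof cases
    case lin
    then obtain k L g where k: "k \<le> n" "\<forall>j\<in>{1..k}. continuous_linear_functional \<gamma> d (L j)"
      "\<forall>f\<in>F \<gamma> d. A f = (\<lambda>x. \<Sum>j=1..k. L j f * g j x)"
      unfolding linear_algorithms_def by auto
    have "k < 2 ^ s" "\<forall>j<k. continuous_functional \<gamma> d (L (Suc j))"
      using n k(1,2) by (auto simp: continuous_linear_functional_def)
    from indistinguishable_pair[of k "\<lambda>j. L (Suc j)", OF this]
    obtain u v where uv: "u \<in> F \<gamma> d" "v \<in> F \<gamma> d" "F_norm \<gamma> d u \<le> 1" "F_norm \<gamma> d v \<le> 1"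
      "\<forall>j<k. L (Suc j) u = L (Suc j) v" "\<exists>x\<in>cube d. \<bar>u x - v x\<bar> = 2"
      by blast
    have "L j u = L j v" if "j \<in> {1..k}" for j
      using uv(5)[rule_format, of "j - 1"] that by (cases j) auto
    then have "A u = A v"
      using uv(1,2) k(3) by simp
    with uv show ?thesis by (intro bexI[of _ u] bexI[of _ v] conjI)
  next
    case nonad
    then obtain k L \<phi> where k: "k \<le> n" "\<forall>j\<in>{1..k}. continuous_functional \<gamma> d (L j)"
      "\<forall>f\<in>F \<gamma> d. A f = \<phi> (map (\<lambda>j. L j f) [1..<k + 1])"
      unfolding nonadaptive_continuous_algorithms_def by auto
    have "k < 2 ^ s" "\<forall>j<k. continuous_functional \<gamma> d (L (Suc j))"
      using n k(1,2) by auto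
    from indistinguishable_pair[of k "\<lambda>j. L (Suc j)", OF this]
    obtain u v where uv: "u \<in> F \<gamma> d" "v \<in> F \<gamma> d" "F_norm \<gamma> d u \<le> 1" "F_norm \<gamma> d v \<le> 1"
      "\<forall>j<k. L (Suc j) u = L (Suc j) v" "\<exists>x\<in>cube d. \<bar>u x - v x\<bar> = 2"
      by blast
    have "L j u = L j v" if "j \<in> set [1..<k + 1]" for j
      using uv(5)[rule_format, of "j - 1"] that by (cases j) auto
    then have "map (\<lambda>j. L j u) [1..<k + 1] = map (\<lambda>j. L j v) [1..<k + 1]"
      by (intro map_cong refl)
    then have "A u = A v"
      unfolding k(3)[rule_format, OF uv(1)] k(3)[rule_format, OF uv(2)] by (rule arg_cong)
    with uv show ?thesis by (intro bexI[of _ u] bexI[of _ v] conjI)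
  next
    case adap
    then obtain k L \<phi> where k: "k \<le> n" "\<forall>ys. length ys < k \<longrightarrow> continuous_linear_functional \<gamma> d (L ys)"
      "\<forall>f\<in>F \<gamma> d. A f = \<phi> (adaptive_information L f k)"
      unfolding adaptive_linear_algorithms_def by auto
    \<comment> \<open>Following only answers 0, the adaptive functionals reduce to a fixed list of
      linear ones. If \<open>u\<close> and \<open>v\<close> agree on this list, all multiples of
      \<open>u - v\<close> vanish on it and stay on the branch of zero answers; one half and minus
      one half of \<open>u - v\<close> have norm at most 1 and differ by
      \<open>u - v\<close>.\<close>
    have lin: "continuous_linear_functional \<gamma> d (L (replicate j 0))" if "j < k" for j
      using k(2) that by simp
    have "k < 2 ^ s" "\<forall>j<k. continuous_functional \<gamma> d (L (replicate j 0))"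
      using n k(1) lin by (auto simp: continuous_linear_functional_def)
    from indistinguishable_pair[of k "\<lambda>j. L (replicate j 0)", OF this]
    obtain u v where uv: "u \<in> F \<gamma> d" "v \<in> F \<gamma> d" "F_norm \<gamma> d u \<le> 1" "F_norm \<gamma> d v \<le> 1"
      "\<forall>j<k. L (replicate j 0) u = L (replicate j 0) v" "\<exists>x\<in>cube d. \<bar>u x - v x\<bar> = 2"
      by blast
    define w where "w a = (\<lambda>x. a * u x + (- a) * v x)" for a :: real
    have wF: "w a \<in> F \<gamma> d" for a
      unfolding w_def by (rule F_linear[OF uv(1,2)])
    have "F_norm \<gamma> d (w a) \<le> ereal (\<bar>a\<bar> * 1 + \<bar>- a\<bar> * 1)" for a
      unfolding w_def by (rule F_norm_linear[OF uv(1,2)]) (use uv in \<open>simp_all add: one_ereal_def\<close>)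
    from this[of "1/2"] this[of "-1/2"] have wn: "F_norm \<gamma> d (w (1/2)) \<le> 1" "F_norm \<gamma> d (w (-1/2)) \<le> 1"
      by (simp_all add: one_ereal_def)
    have zero: "L (replicate j 0) (w a) = 0" if "j < k" for j a
      unfolding w_def continuous_linear_functional_linear[OF lin[OF that] uv(1,2)]
      using uv(5) that by simp
    have "adaptive_information L (w a) k = replicate k 0" for a
      by (rule adaptive_information_zeros) (rule zero)
    then have "A (w (1/2)) = A (w (-1/2))"
      unfolding k(3)[rule_format, OF wF] by simp
    moreover have "w (1/2) x - w (-1/2) x = u x - v x" for x
      by (simp add: w_def)
    then have "\<exists>x\<in>cube d. \<bar>w (1/2) x - w (-1/2) x\<bar> = 2"
      using uv(6) by simp
    ultimately show ?thesis
      using wF wn by blast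
  qed
qed

theorem minimal_error_ge_1:
  assumes n: "n < 2 ^ s" and algs: "algs = linear_algorithms \<gamma> \<or> algs = nonlinear_algorithms \<gamma>"
  shows "1 \<le> minimal_error \<gamma> algs n d"
  unfolding minimal_error_def
proof (rule INF_greatest)
  fix A assume "A \<in> algs d n"
  with algs have "A \<in> linear_algorithms \<gamma> d n \<or> A \<in> nonlinear_algorithms \<gamma> d n" by auto
  from unit_ball_collision[OF n this]
  obtain u v x where u: "u \<in> F \<gamma> d" "F_norm \<gamma> d u \<le> 1" and v: "v \<in> F \<gamma> d" "F_norm \<gamma> d v \<le> 1"
    and eq: "A u = A v" and x: "x \<in> cube d" "\<bar>u x - v x\<bar> = 2"
    by (elim bexE conjE)
  have "1 \<le> Linf_norm d (\<lambda>x. u x - A u x) \<or> 1 \<le> Linf_norm d (\<lambda>x. v x - A u x)"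
    by (rule Linf_norm_separated[OF _ _ x(1)]) (use u v x(2) in \<open>auto simp: F_def intro: smooth_on_cubeD\<close>)
  then show "1 \<le> (SUP f \<in> {f \<in> F \<gamma> d. F_norm \<gamma> d f \<le> 1}. Linf_norm d (\<lambda>x. f x - A f x))"
  proof
    assume "1 \<le> Linf_norm d (\<lambda>x. u x - A u x)"
    then show ?thesis by (rule order.trans) (rule SUP_upper, use u in simp)
  next
    assume "1 \<le> Linf_norm d (\<lambda>x. v x - A u x)"
    then show ?thesis unfolding eq by (rule order.trans) (rule SUP_upper, use v in simp)
  qed
qed

end

section \<open>Taylor approximation\<close>

text \<open>The denominator \<open>fact K\<close> is the one in \<open>field_Taylor\<close>, and the
  power of \<open>x j\<close> is at most 1. This is precise enough, since the remainder only has to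
  vanish as \<open>K\<close> grows.\<close>

lemma coordinate_Taylor:
  assumes g: "smooth_on_cube d g" and j: "j \<in> {1..d}" and x: "x \<in> cube d"
    and B: "\<And>y. y \<in> cube d \<Longrightarrow> \<bar>iterated_deriv d (replicate (Suc K) j) g y\<bar> \<le> B"
  shows "\<bar>g x - (\<Sum>k\<le>K. iterated_deriv d (replicate k j) g (x(j := 0)) * x j ^ k / fact k)\<bar> \<le> B / fact K"
proof -
  define h where "h i t = iterated_deriv d (replicate i j) g (x(j := t))" for i t
  have xj: "x j \<in> {0..1}" using x j by (auto simp: cube_def PiE_iff)
  have B0: "0 \<le> B" using B[OF x] by linarith
  have deriv: "(h i has_field_derivative h (Suc i) t) (at t within {0..1})" if t: "t \<in> {0..1}" for i t
  proof -
    have js: "replicate i j \<in> lists {1..d}" using j by auto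
    have "replicate (Suc i) j = replicate i j @ [j]"
      by (simp add: replicate_append_same)
    then have "iterated_deriv d (replicate (Suc i) j) g = partial_deriv d j (iterated_deriv d (replicate i j) g)"
      by (simp only: iterated_deriv_append iterated_deriv_Cons iterated_deriv_Nil)
    then show ?thesis
      using smooth_on_cubeD(2)[OF smooth_on_cube_iterated_deriv[OF g js] j cube_upd[OF x j t]]
      by (simp add: h_def[abs_def] has_real_derivative_iff_has_vector_derivative)
  qed
  have "norm (h 0 (x j) - (\<Sum>k\<le>K. h k 0 * (x j - 0) ^ k / fact k)) \<le> B * norm (x j - 0) ^ Suc K / fact K"
  proof (rule field_Taylor[of "{0..1}" K h B 0 "x j"])
    show "norm (h (Suc K) t) \<le> B" if "t \<in> {0..1}" for t
      using B[OF cube_upd[OF x j that]] by (simp only: h_def real_norm_def)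
  qed (use deriv xj in auto)
  also have "\<dots> \<le> B / fact K"
  proof (intro divide_right_mono)
    have "norm (x j - 0) ^ Suc K \<le> 1"
      using xj by (intro power_le_one) auto
    then show "B * norm (x j - 0) ^ Suc K \<le> B"
      using B0 by (simp only: mult_left_le)
  qed simp
  finally show ?thesis by (simp add: h_def)
qed

lemma index_list_zeros:
  "m \<le> n \<Longrightarrow> (\<And>j. m < j \<Longrightarrow> j \<le> n \<Longrightarrow> \<alpha> j = 0) \<Longrightarrow> index_list \<alpha> n = index_list \<alpha> m"
proof (induction n rule: nat_induct_at_least[of m])
  case (Suc n)
  then show ?case by (simp add: index_list_Suc)
qed simp

lemma sum_PiE_Suc:
  fixes g :: "(nat \<Rightarrow> nat) \<Rightarrow> real"
  shows "(\<Sum>\<alpha>\<in>{1..Suc m} \<rightarrow>\<^sub>E {..K}. g \<alpha>) = (\<Sum>\<alpha>\<in>{1..m} \<rightarrow>\<^sub>E {..K}. \<Sum>k\<le>K. g (\<alpha>(Suc m := k)))"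
proof -
  have "{1..Suc m} = insert (Suc m) {1..m}" by auto
  then have "(\<Sum>\<alpha>\<in>{1..Suc m} \<rightarrow>\<^sub>E {..K}. g \<alpha>) = (\<Sum>\<alpha>\<in>insert (Suc m) {1..m} \<rightarrow>\<^sub>E {..K}. g \<alpha>)"
    by simp
  also have "\<dots> = (\<Sum>(k, \<alpha>)\<in>{..K} \<times> ({1..m} \<rightarrow>\<^sub>E {..K}). g (\<alpha>(Suc m := k)))"
    unfolding PiE_insert_eq
    by (subst sum.reindex[OF inj_combinator]) (auto simp: case_prod_unfold)
  also have "\<dots> = (\<Sum>k\<le>K. \<Sum>\<alpha>\<in>{1..m} \<rightarrow>\<^sub>E {..K}. g (\<alpha>(Suc m := k)))"
    by (rule sum.cartesian_product[symmetric])
  also have "\<dots> = (\<Sum>\<alpha>\<in>{1..m} \<rightarrow>\<^sub>E {..K}. \<Sum>k\<le>K. g (\<alpha>(Suc m := k)))"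
    by (rule sum.swap)
  finally show ?thesis .
qed

lemma sum_power_fact_le_exp:
  fixes t :: real
  assumes "t \<ge> 0"
  shows "(\<Sum>k\<le>K. t ^ k / fact k) \<le> exp t"
proof -
  have "(\<lambda>k. t ^ k / fact k) sums exp t"
    using exp_converges[of t] by (simp add: divide_inverse mult.commute scaleR_conv_of_real)
  then have "summable (\<lambda>k. t ^ k / fact k)" "suminf (\<lambda>k. t ^ k / fact k) = exp t"
    by (simp_all add: sums_iff)
  then show ?thesis
    using sum_le_suminf[of "\<lambda>k. t ^ k / fact k" "{..K}"] assms by simp
qed

definition monomial :: "nat \<Rightarrow> (nat \<Rightarrow> nat) \<Rightarrow> (nat \<Rightarrow> real) \<Rightarrow> real" where
  "monomial m \<alpha> x = (\<Prod>j=1..m. x j ^ \<alpha> j / fact (\<alpha> j))"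

lemma monomial_Suc: "monomial (Suc m) (\<alpha>(Suc m := k)) x = monomial m \<alpha> x * (x (Suc m) ^ k / fact k)"
proof -
  have "monomial (Suc m) (\<alpha>(Suc m := k)) x =
      (\<Prod>j=1..m. x j ^ (\<alpha>(Suc m := k)) j / fact ((\<alpha>(Suc m := k)) j)) * (x (Suc m) ^ k / fact k)"
    unfolding monomial_def by (subst prod.nat_ivl_Suc') simp_all
  also have "(\<Prod>j=1..m. x j ^ (\<alpha>(Suc m := k)) j / fact ((\<alpha>(Suc m := k)) j)) = monomial m \<alpha> x"
    unfolding monomial_def by (rule prod.cong) auto
  finally show ?thesis .
qed

lemma abs_monomial_le:
  assumes "x \<in> cube d" "m \<le> d"
  shows "\<bar>monomial m \<alpha> x\<bar> \<le> (\<Prod>j=1..m. 1 / fact (\<alpha> j))"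
  unfolding monomial_def abs_prod
proof (intro prod_mono conjI)
  fix j assume "j \<in> {1..m}"
  with assms have "x j \<in> {0..1}" by (auto simp: cube_def PiE_iff)
  then show "\<bar>x j ^ \<alpha> j / fact (\<alpha> j)\<bar> \<le> 1 / fact (\<alpha> j)"
    by (simp add: abs_divide divide_right_mono power_le_one)
qed simp

text \<open>Leads from \<open>x\<close> at \<open>m = 0\<close> to the origin at
  \<open>m = d\<close>, for an expansion that treats one coordinate at a time.\<close>

definition partial_origin :: "nat \<Rightarrow> (nat \<Rightarrow> real) \<Rightarrow> nat \<Rightarrow> real" where
  "partial_origin m x = (\<lambda>j. if j \<in> {1..m} then 0 else x j)"

lemma partial_origin_in_cube: "x \<in> cube d \<Longrightarrow> m \<le> d \<Longrightarrow> partial_origin m x \<in> cube d"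
  by (auto simp: cube_def PiE_iff partial_origin_def extensional_def)

lemma partial_origin_Suc: "partial_origin (Suc m) x = (partial_origin m x)(Suc m := 0)"
  by (auto simp: partial_origin_def fun_eq_iff)

context positive_weights
begin

text \<open>The norm bounds derivatives taken in increasing order of the coordinates. The list here
  has this order, so it belongs to a multi-index \<open>\<beta>\<close>; this is why the coordinates
  are expanded in increasing order.\<close>

lemma abs_iterated_deriv_le:
  assumes f: "smooth_on_cube d f" and norm: "F_norm \<gamma> d f \<le> 1" and m: "Suc m \<le> d" and y: "y \<in> cube d"
  shows "\<bar>iterated_deriv d (index_list \<alpha> m @ replicate k (Suc m)) f y\<bar> \<le>
    (\<Prod>j=1..m. \<gamma> d j ^ \<alpha> j) * \<gamma> d (Suc m) ^ k"
proof -
  define \<beta> :: "nat \<Rightarrow> nat" where "\<beta> = restrict (\<lambda>j. if j \<le> m then \<alpha> j else if j = Suc m then k else 0) {1..d}"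
  have \<beta>: "\<beta> \<in> multi_indices d" by (simp add: \<beta>_def multi_indices_def)
  have "index_list \<beta> d = index_list \<beta> (Suc m)"
    by (rule index_list_zeros[OF m]) (auto simp: \<beta>_def)
  also have "\<dots> = index_list \<beta> m @ replicate k (Suc m)"
    using m by (simp add: index_list_Suc \<beta>_def)
  also have "index_list \<beta> m = index_list \<alpha> m"
    by (rule index_list_cong) (use m in \<open>auto simp: \<beta>_def\<close>)
  finally have il: "index_list \<beta> d = index_list \<alpha> m @ replicate k (Suc m)" .
  have "weight \<gamma> d \<beta> = (\<Prod>j\<in>{1..Suc m}. \<gamma> d j ^ \<beta> j)"
    unfolding weight_def by (rule prod.mono_neutral_right) (use m in \<open>auto simp: \<beta>_def\<close>)
  also have "\<dots> = (\<Prod>j=1..m. \<gamma> d j ^ \<beta> j) * \<gamma> d (Suc m) ^ \<beta> (Suc m)"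
    by simp
  also have "(\<Prod>j=1..m. \<gamma> d j ^ \<beta> j) = (\<Prod>j=1..m. \<gamma> d j ^ \<alpha> j)"
    by (rule prod.cong) (use m in \<open>auto simp: \<beta>_def\<close>)
  also have "\<beta> (Suc m) = k"
    using m by (simp add: \<beta>_def)
  finally have w: "weight \<gamma> d \<beta> = (\<Prod>j=1..m. \<gamma> d j ^ \<alpha> j) * \<gamma> d (Suc m) ^ k" .
  show ?thesis
    using F_normD[OF f _ \<beta> y, of 1] norm unfolding multi_deriv_index_list il w by (simp add: one_ereal_def)
qed

text \<open>Bounds, uniformly in \<open>K\<close>, the total weight with which the remainders of one
  coordinate enter; the sum over a box of multi-indices factorises.\<close>

lemma sum_prod_le_exp:
  assumes "m \<le> d"
  shows "(\<Sum>\<alpha>\<in>{1..m} \<rightarrow>\<^sub>E {..K}. \<Prod>j=1..m. \<gamma> d j ^ \<alpha> j / fact (\<alpha> j)) \<le> exp (\<Sum>j=1..d. \<gamma> d j)"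
proof -
  have "(\<Sum>\<alpha>\<in>{1..m} \<rightarrow>\<^sub>E {..K}. \<Prod>j=1..m. \<gamma> d j ^ \<alpha> j / fact (\<alpha> j)) = (\<Prod>j=1..m. \<Sum>k\<le>K. \<gamma> d j ^ k / fact k)"
    by (rule prod_sum_PiE[symmetric]) auto
  also have "\<dots> \<le> (\<Prod>j=1..m. exp (\<gamma> d j))"
  proof (intro prod_mono conjI)
    fix j assume "j \<in> {1..m}"
    then have "\<gamma> d j > 0" using assms by (intro pos) auto
    then show "(\<Sum>k\<le>K. \<gamma> d j ^ k / fact k) \<le> exp (\<gamma> d j)" "0 \<le> (\<Sum>k\<le>K. \<gamma> d j ^ k / fact k)"
      by (auto intro!: sum_power_fact_le_exp sum_nonneg)
  qed
  also have "\<dots> = exp (\<Sum>j=1..m. \<gamma> d j)" by (simp add: exp_sum)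
  also have "\<dots> \<le> exp (\<Sum>j=1..d. \<gamma> d j)"
    unfolding exp_le_cancel_iff by (rule sum_mono2) (use assms pos in \<open>auto intro: less_imp_le\<close>)
  finally show ?thesis .
qed

text \<open>The terms of stage \<open>m\<close> still see the original values of the later
  coordinates, so each is a smooth function to which \<open>coordinate_Taylor\<close> applies in the
  coordinate \<open>Suc m\<close>. The remainders, each with the weight of its term, add up to a
  factor independent of \<open>K\<close> times a one-dimensional remainder.\<close>

lemma box_Taylor:
  assumes f: "smooth_on_cube d f" and norm: "F_norm \<gamma> d f \<le> 1" and x: "x \<in> cube d" and "m \<le> d"
  shows "\<bar>f x - (\<Sum>\<alpha>\<in>{1..m} \<rightarrow>\<^sub>E {..K}. iterated_deriv d (index_list \<alpha> m) f (partial_origin m x) * monomial m \<alpha> x)\<bar>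
    \<le> (\<Sum>j=1..m. exp (\<Sum>j=1..d. \<gamma> d j) * (\<gamma> d j ^ Suc K / fact K))"
  using \<open>m \<le> d\<close>
proof (induction m)
  case 0
  then show ?case by (simp add: monomial_def partial_origin_def)
next
  case (Suc m)
  let ?j = "Suc m" and ?o = "partial_origin m x" and ?G = "exp (\<Sum>j=1..d. \<gamma> d j)"
  let ?g = "\<lambda>\<alpha>. iterated_deriv d (index_list \<alpha> m) f"
  let ?T = "\<lambda>\<alpha>. \<Sum>k\<le>K. iterated_deriv d (replicate k ?j) (?g \<alpha>) (?o(?j := 0)) * ?o ?j ^ k / fact k"
  have md: "m \<le> d" and j: "?j \<in> {1..d}" using Suc.prems by auto
  have o: "?o \<in> cube d" by (rule partial_origin_in_cube[OF x md])
  have oj: "?o ?j = x ?j" by (simp add: partial_origin_def)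
  have il: "index_list (\<alpha>(?j := k)) ?j = index_list \<alpha> m @ replicate k ?j" for \<alpha> k
    using index_list_cong[of m "\<alpha>(?j := k)" \<alpha>] unfolding index_list_Suc by simp
  have "(\<Sum>\<alpha>\<in>{1..?j} \<rightarrow>\<^sub>E {..K}. iterated_deriv d (index_list \<alpha> ?j) f (partial_origin ?j x) * monomial ?j \<alpha> x) =
      (\<Sum>\<alpha>\<in>{1..m} \<rightarrow>\<^sub>E {..K}. \<Sum>k\<le>K. iterated_deriv d (replicate k ?j) (?g \<alpha>) (?o(?j := 0)) *
        (monomial m \<alpha> x * (x ?j ^ k / fact k)))"
    unfolding sum_PiE_Suc monomial_Suc il iterated_deriv_append partial_origin_Suc ..
  also have "\<dots> = (\<Sum>\<alpha>\<in>{1..m} \<rightarrow>\<^sub>E {..K}. ?T \<alpha> * monomial m \<alpha> x)"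
    unfolding oj sum_distrib_right by (simp add: mult_ac)
  finally have T: "(\<Sum>\<alpha>\<in>{1..?j} \<rightarrow>\<^sub>E {..K}. iterated_deriv d (index_list \<alpha> ?j) f (partial_origin ?j x) * monomial ?j \<alpha> x) =
      (\<Sum>\<alpha>\<in>{1..m} \<rightarrow>\<^sub>E {..K}. ?T \<alpha> * monomial m \<alpha> x)" .
  have step: "\<bar>?g \<alpha> ?o * monomial m \<alpha> x - ?T \<alpha> * monomial m \<alpha> x\<bar> \<le>
      (\<Prod>i=1..m. \<gamma> d i ^ \<alpha> i / fact (\<alpha> i)) * (\<gamma> d ?j ^ Suc K / fact K)" for \<alpha>
  proof -
    have "\<bar>?g \<alpha> ?o - ?T \<alpha>\<bar> \<le> (\<Prod>i=1..m. \<gamma> d i ^ \<alpha> i) * \<gamma> d ?j ^ Suc K / fact K"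
    proof (rule coordinate_Taylor[OF _ j o])
      show "smooth_on_cube d (?g \<alpha>)"
        by (intro smooth_on_cube_iterated_deriv f index_list_in_lists md)
      fix y assume "y \<in> cube d"
      then show "\<bar>iterated_deriv d (replicate (Suc K) ?j) (?g \<alpha>) y\<bar> \<le> (\<Prod>i=1..m. \<gamma> d i ^ \<alpha> i) * \<gamma> d ?j ^ Suc K"
        using abs_iterated_deriv_le[OF f norm Suc.prems, of y \<alpha> "Suc K"]
        unfolding iterated_deriv_append by blast
    qed
    then have "\<bar>?g \<alpha> ?o - ?T \<alpha>\<bar> * \<bar>monomial m \<alpha> x\<bar> \<le>
        ((\<Prod>i=1..m. \<gamma> d i ^ \<alpha> i) * \<gamma> d ?j ^ Suc K / fact K) * (\<Prod>j=1..m. 1 / fact (\<alpha> j))"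
      by (intro mult_mono' abs_monomial_le[OF x md]) auto
    also have "\<dots> = (\<Prod>i=1..m. \<gamma> d i ^ \<alpha> i / fact (\<alpha> i)) * (\<gamma> d ?j ^ Suc K / fact K)"
      by (simp add: prod_dividef)
    finally show ?thesis
      by (simp only: abs_mult[symmetric] left_diff_distrib)
  qed
  have "\<bar>(\<Sum>\<alpha>\<in>{1..m} \<rightarrow>\<^sub>E {..K}. ?g \<alpha> ?o * monomial m \<alpha> x) - (\<Sum>\<alpha>\<in>{1..m} \<rightarrow>\<^sub>E {..K}. ?T \<alpha> * monomial m \<alpha> x)\<bar> \<le>
      (\<Sum>\<alpha>\<in>{1..m} \<rightarrow>\<^sub>E {..K}. \<bar>?g \<alpha> ?o * monomial m \<alpha> x - ?T \<alpha> * monomial m \<alpha> x\<bar>)"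
    unfolding sum_subtractf[symmetric] by (rule sum_abs)
  also have "\<dots> \<le> (\<Sum>\<alpha>\<in>{1..m} \<rightarrow>\<^sub>E {..K}. (\<Prod>i=1..m. \<gamma> d i ^ \<alpha> i / fact (\<alpha> i)) * (\<gamma> d ?j ^ Suc K / fact K))"
    by (intro sum_mono step)
  also have "\<dots> = (\<Sum>\<alpha>\<in>{1..m} \<rightarrow>\<^sub>E {..K}. \<Prod>i=1..m. \<gamma> d i ^ \<alpha> i / fact (\<alpha> i)) * (\<gamma> d ?j ^ Suc K / fact K)"
    by (rule sum_distrib_right[symmetric])
  also have "\<dots> \<le> ?G * (\<gamma> d ?j ^ Suc K / fact K)"
    using pos[OF j] by (intro mult_right_mono sum_prod_le_exp md) simp
  finally show ?case
    using Suc.IH[OF md] unfolding T by simp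
qed

end

section \<open>Truncated Taylor expansions as algorithms\<close>

definition origin :: "nat \<Rightarrow> nat \<Rightarrow> real" where
  "origin d = restrict (\<lambda>_. 0) {1..d}"

lemma origin_in_cube: "origin d \<in> cube d"
  by (auto simp: origin_def cube_def)

lemma partial_origin_eq_origin: "x \<in> cube d \<Longrightarrow> partial_origin d x = origin d"
  by (auto simp: partial_origin_def origin_def cube_def PiE_iff extensional_def fun_eq_iff)

lemma continuous_on_monomial: "continuous_on K (monomial d \<alpha>)"
  unfolding monomial_def[abs_def]
  by (intro continuous_intros continuous_on_subset[OF continuous_on_product_coordinates]) auto

lemma abs_monomial_le_1: "x \<in> cube d \<Longrightarrow> \<bar>monomial d \<alpha> x\<bar> \<le> 1"
  by (rule order.trans[OF abs_monomial_le[OF _ order.refl]]) (auto intro!: prod_le_1 simp: divide_le_eq_1 fact_ge_1)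

definition Taylor_weight :: "(nat \<Rightarrow> nat \<Rightarrow> real) \<Rightarrow> nat \<Rightarrow> (nat \<Rightarrow> nat) \<Rightarrow> real" where
  "Taylor_weight \<gamma> d \<alpha> = (\<Prod>j=1..d. \<gamma> d j ^ \<alpha> j / fact (\<alpha> j))"

lemma multi_indices_box:
  assumes "finite A" "A \<subseteq> multi_indices d"
  shows "\<exists>K. \<forall>L\<ge>K. A \<subseteq> {1..d} \<rightarrow>\<^sub>E {..L::nat}"
proof -
  define K where "K = Max (insert 0 ((\<lambda>(\<alpha>, j). \<alpha> j) ` (A \<times> {1..d})))"
  have K: "\<alpha> j \<le> K" if "\<alpha> \<in> A" "j \<in> {1..d}" for \<alpha> j
    unfolding K_def
  proof (rule Max_ge)
    have "(\<lambda>(\<alpha>, j). \<alpha> j) (\<alpha>, j) \<in> (\<lambda>(\<alpha>, j). \<alpha> j) ` (A \<times> {1..d})"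
      by (rule imageI) (use that in simp)
    then show "\<alpha> j \<in> insert 0 ((\<lambda>(\<alpha>, j). \<alpha> j) ` (A \<times> {1..d}))" by simp
  qed (use assms(1) in simp)
  have "A \<subseteq> {1..d} \<rightarrow>\<^sub>E {..L}" if L: "K \<le> L" for L
  proof
    fix \<alpha> assume \<alpha>: "\<alpha> \<in> A"
    with assms(2) have \<alpha>': "\<alpha> \<in> {1..d} \<rightarrow>\<^sub>E UNIV" by (auto simp: multi_indices_def)
    show "\<alpha> \<in> {1..d} \<rightarrow>\<^sub>E {..L}"
    proof (rule PiE_I)
      show "\<alpha> j \<in> {..L}" if "j \<in> {1..d}" for j
        using K[OF \<alpha> that] L by simp
      show "\<alpha> j = undefined" if "j \<notin> {1..d}" for j
        using PiE_arb[OF \<alpha>' that] .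
    qed
  qed
  then show ?thesis by (intro exI[of _ K] allI impI)
qed

context positive_weights
begin

lemma Taylor_weight_pos: "Taylor_weight \<gamma> d \<alpha> > 0"
  unfolding Taylor_weight_def by (intro prod_pos divide_pos_pos zero_less_power pos) auto

lemma abs_Taylor_term_le:
  assumes f: "smooth_on_cube d f" and norm: "F_norm \<gamma> d f \<le> 1" and x: "x \<in> cube d"
    and \<alpha>: "\<alpha> \<in> multi_indices d"
  shows "\<bar>multi_deriv d \<alpha> f (origin d) * monomial d \<alpha> x\<bar> \<le> Taylor_weight \<gamma> d \<alpha>"
proof -
  have "\<bar>multi_deriv d \<alpha> f (origin d) * monomial d \<alpha> x\<bar> \<le> weight \<gamma> d \<alpha> * (\<Prod>j=1..d. 1 / fact (\<alpha> j))"
    unfolding abs_mult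
  proof (intro mult_mono' abs_monomial_le[OF x order.refl])
    show "\<bar>multi_deriv d \<alpha> f (origin d)\<bar> \<le> weight \<gamma> d \<alpha>"
      using F_normD[OF f _ \<alpha> origin_in_cube, of 1] norm by (simp add: one_ereal_def)
  qed auto
  also have "\<dots> = Taylor_weight \<gamma> d \<alpha>"
    by (simp add: weight_def Taylor_weight_def prod_dividef)
  finally show ?thesis .
qed

text \<open>A large box contains \<open>A\<close>; the part of the box outside \<open>A\<close> is a
  finite set to which \<open>tail\<close> applies, and the box remainder \<open>R K\<close> tends to
  0. So no infinite sum over multi-indices is formed.\<close>

lemma truncated_Taylor:
  assumes f: "smooth_on_cube d f" and norm: "F_norm \<gamma> d f \<le> 1" and x: "x \<in> cube d"
    and A: "finite A" "A \<subseteq> multi_indices d"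
    and tail: "\<And>B. finite B \<Longrightarrow> B \<subseteq> multi_indices d - A \<Longrightarrow> (\<Sum>\<alpha>\<in>B. Taylor_weight \<gamma> d \<alpha>) \<le> \<epsilon>"
  shows "\<bar>f x - (\<Sum>\<alpha>\<in>A. multi_deriv d \<alpha> f (origin d) * monomial d \<alpha> x)\<bar> \<le> \<epsilon>"
proof -
  let ?t = "\<lambda>\<alpha>. multi_deriv d \<alpha> f (origin d) * monomial d \<alpha> x"
  define R where "R K = (\<Sum>j=1..d. exp (\<Sum>j=1..d. \<gamma> d j) * (\<gamma> d j ^ Suc K / fact K))" for K
  have "(\<lambda>K. t ^ Suc K / fact K) \<longlonglongrightarrow> 0" for t :: real
  proof -
    have "(\<lambda>K. t * (inverse (fact K) * t ^ K)) \<longlonglongrightarrow> t * 0"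
      by (intro tendsto_mult tendsto_const summable_LIMSEQ_zero summable_exp)
    then show ?thesis by (simp add: field_simps)
  qed
  then have "R \<longlonglongrightarrow> (\<Sum>j=1..d. exp (\<Sum>j=1..d. \<gamma> d j) * 0)"
    unfolding R_def[abs_def] by (intro tendsto_sum tendsto_mult tendsto_const)
  then have lim: "(\<lambda>K. R K + \<epsilon>) \<longlonglongrightarrow> 0 + \<epsilon>"
    by (intro tendsto_add tendsto_const) simp
  obtain K0 where K0: "\<forall>K\<ge>K0. A \<subseteq> {1..d} \<rightarrow>\<^sub>E {..K}"
    using multi_indices_box[OF A] by (elim exE)
  have bound: "\<bar>f x - (\<Sum>\<alpha>\<in>A. ?t \<alpha>)\<bar> \<le> R K + \<epsilon>" if K: "K \<ge> K0" for K
  proof -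
    let ?B = "{1..d} \<rightarrow>\<^sub>E {..K}"
    have fin: "finite ?B" by (intro finite_PiE) auto
    have sub: "?B \<subseteq> multi_indices d" by (auto simp: multi_indices_def PiE_iff)
    have "\<bar>f x - (\<Sum>\<alpha>\<in>?B. ?t \<alpha>)\<bar> \<le> R K"
      using box_Taylor[OF f norm x order.refl, of K]
      unfolding R_def partial_origin_eq_origin[OF x] multi_deriv_index_list .
    moreover have "(\<Sum>\<alpha>\<in>?B. ?t \<alpha>) = (\<Sum>\<alpha>\<in>?B - A. ?t \<alpha>) + (\<Sum>\<alpha>\<in>A. ?t \<alpha>)"
      using K0 K fin by (intro sum.subset_diff) auto
    moreover have "\<bar>\<Sum>\<alpha>\<in>?B - A. ?t \<alpha>\<bar> \<le> \<epsilon>"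
    proof -
      have "\<bar>\<Sum>\<alpha>\<in>?B - A. ?t \<alpha>\<bar> \<le> (\<Sum>\<alpha>\<in>?B - A. \<bar>?t \<alpha>\<bar>)" by (rule sum_abs)
      also have "\<dots> \<le> (\<Sum>\<alpha>\<in>?B - A. Taylor_weight \<gamma> d \<alpha>)"
        by (rule sum_mono) (use sub in \<open>auto intro!: abs_Taylor_term_le[OF f norm x]\<close>)
      also have "\<dots> \<le> \<epsilon>"
        by (rule tail) (use fin sub in auto)
      finally show ?thesis .
    qed
    ultimately show ?thesis by linarith
  qed
  have "\<bar>f x - (\<Sum>\<alpha>\<in>A. ?t \<alpha>)\<bar> \<le> 0 + \<epsilon>"
    by (rule LIMSEQ_le_const[OF lim]) (use bound in blast)
  then show ?thesis by simp
qed

lemma continuous_linear_functional_multi_deriv: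
  assumes \<alpha>: "\<alpha> \<in> multi_indices d"
  shows "continuous_linear_functional \<gamma> d (\<lambda>f. multi_deriv d \<alpha> f (origin d))"
  unfolding continuous_linear_functional_def continuous_functional_def
proof (intro conjI ballI allI impI)
  fix f g assume f: "f \<in> F \<gamma> d" and g: "g \<in> F \<gamma> d"
  then have sm: "smooth_on_cube d f" "smooth_on_cube d g" by (simp_all add: F_def)
  show "multi_deriv d \<alpha> (\<lambda>x. f x + g x) (origin d) = multi_deriv d \<alpha> f (origin d) + multi_deriv d \<alpha> g (origin d)"
    using multi_deriv_linear[OF sm, of \<alpha> 1 1] by simp
next
  fix c f assume f: "f \<in> F \<gamma> d"
  then have sm: "smooth_on_cube d f" by (simp add: F_def)
  show "multi_deriv d \<alpha> (\<lambda>x. c * f x) (origin d) = c * multi_deriv d \<alpha> f (origin d)"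
    using multi_deriv_linear[OF sm sm, of \<alpha> c 0] by simp
next
  fix f and \<epsilon> :: real assume f: "f \<in> F \<gamma> d" and \<epsilon>: "\<epsilon> > 0"
  let ?\<delta> = "\<epsilon> / (2 * weight \<gamma> d \<alpha>)"
  have w: "weight \<gamma> d \<alpha> > 0" by (rule weight_pos)
  have "\<bar>multi_deriv d \<alpha> g (origin d) - multi_deriv d \<alpha> f (origin d)\<bar> < \<epsilon>"
    if g: "g \<in> F \<gamma> d" and less: "F_norm \<gamma> d (\<lambda>x. g x - f x) < ereal ?\<delta>" for g
  proof -
    have sm: "smooth_on_cube d f" "smooth_on_cube d g" using f g by (simp_all add: F_def)
    have "smooth_on_cube d (\<lambda>x. g x - f x)"
      using smooth_on_cube_linear[OF sm(2,1), of 1 "-1"] by simp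
    from F_normD[OF this less_imp_le[OF less] \<alpha> origin_in_cube]
    have "\<bar>multi_deriv d \<alpha> (\<lambda>x. g x - f x) (origin d)\<bar> \<le> weight \<gamma> d \<alpha> * ?\<delta>" .
    also have "\<dots> < \<epsilon>" using w \<epsilon> by simp
    finally show ?thesis
      using multi_deriv_linear[OF sm(2,1), of \<alpha> 1 "-1"] by simp
  qed
  then show "\<exists>\<delta>>0. \<forall>g\<in>F \<gamma> d. F_norm \<gamma> d (\<lambda>x. g x - f x) < ereal \<delta> \<longrightarrow>
      \<bar>multi_deriv d \<alpha> g (origin d) - multi_deriv d \<alpha> f (origin d)\<bar> < \<epsilon>"
    using w \<epsilon> by (intro exI[of _ ?\<delta>]) simp
qed

text \<open>One map for both classes: among the nonlinear algorithms it is nonadaptive, with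
  \<open>\<phi>\<close> rebuilding the polynomial from the list of Taylor coefficients.\<close>

lemma Taylor_algorithm:
  assumes A: "finite A" "A \<subseteq> multi_indices d"
  shows "(\<lambda>f x. \<Sum>\<alpha>\<in>A. multi_deriv d \<alpha> f (origin d) * monomial d \<alpha> x) \<in> linear_algorithms \<gamma> d (card A)"
    and "(\<lambda>f x. \<Sum>\<alpha>\<in>A. multi_deriv d \<alpha> f (origin d) * monomial d \<alpha> x) \<in> nonlinear_algorithms \<gamma> d (card A)"
proof -
  obtain e where e: "bij_betw e {1..card A} A"
    using ex_bij_betw_nat_finite_1[OF A(1)] by (elim exE)
  define L where "L j f = multi_deriv d (e j) f (origin d)" for j f
  define g where "g j = monomial d (e j)" for j
  have eq: "(\<Sum>\<alpha>\<in>A. multi_deriv d \<alpha> f (origin d) * monomial d \<alpha> x) = (\<Sum>j=1..card A. L j f * g j x)" for f x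
    unfolding L_def g_def by (rule sum.reindex_bij_betw[OF e, symmetric])
  have L: "continuous_linear_functional \<gamma> d (L j)" if "j \<in> {1..card A}" for j
  proof -
    have "e j \<in> multi_indices d" using bij_betwE[OF e] that A(2) by blast
    then show ?thesis unfolding L_def[abs_def] by (rule continuous_linear_functional_multi_deriv)
  qed
  have g: "continuous_on (cube d) (g j)" "\<And>x. x \<in> cube d \<Longrightarrow> \<bar>g j x\<bar> \<le> 1" for j
    unfolding g_def by (rule continuous_on_monomial, rule abs_monomial_le_1)
  have gL: "g j \<in> Linf d" for j
    by (rule bounded_continuous_in_Linf[OF g])
  show "(\<lambda>f x. \<Sum>\<alpha>\<in>A. multi_deriv d \<alpha> f (origin d) * monomial d \<alpha> x) \<in> linear_algorithms \<gamma> d (card A)"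
    unfolding linear_algorithms_def eq
    by (intro CollectI exI[of _ "card A"] exI[of _ L] exI[of _ g] conjI ballI order.refl refl L gL)
  define \<phi> where "\<phi> y = (\<lambda>x. \<Sum>j=1..card A. y ! (j - 1) * g j x)" for y :: "real list"
  have \<phi>: "\<phi> y \<in> Linf d" for y
  proof (rule bounded_continuous_in_Linf)
    show "continuous_on (cube d) (\<phi> y)"
      unfolding \<phi>_def by (intro continuous_intros g)
    show "\<bar>\<phi> y x\<bar> \<le> (\<Sum>j=1..card A. \<bar>y ! (j - 1)\<bar>)" if "x \<in> cube d" for x
      unfolding \<phi>_def
      by (intro order.trans[OF sum_abs] sum_mono) (use g(2)[OF that] in \<open>simp add: abs_mult mult_left_le\<close>)
  qed
  have \<phi>_eq: "(\<lambda>x. \<Sum>j=1..card A. L j f * g j x) = \<phi> (map (\<lambda>j. L j f) [1..<card A + 1])" for f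
  proof -
    have "map (\<lambda>j. L j f) [1..<card A + 1] ! (j - 1) = L j f" if "j \<in> {1..card A}" for j
    proof -
      have "j - 1 < card A" "1 + (j - 1) = j" using that by auto
      then show ?thesis by (simp del: upt_Suc)
    qed
    then show ?thesis
      unfolding \<phi>_def by (intro ext sum.cong refl) simp
  qed
  have L': "continuous_functional \<gamma> d (L j)" if "j \<in> {1..card A}" for j
    using L[OF that] by (simp add: continuous_linear_functional_def)
  show "(\<lambda>f x. \<Sum>\<alpha>\<in>A. multi_deriv d \<alpha> f (origin d) * monomial d \<alpha> x) \<in> nonlinear_algorithms \<gamma> d (card A)"
    unfolding nonlinear_algorithms_def nonadaptive_continuous_algorithms_def eq
    by (intro UnI1 CollectI exI[of _ "card A"] exI[of _ L] exI[of _ \<phi>] conjI ballI allI impI order.refl L' \<phi> \<phi>_eq)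
qed

lemma minimal_error_le:
  assumes algs: "algs = linear_algorithms \<gamma> \<or> algs = nonlinear_algorithms \<gamma>"
    and A: "finite A" "A \<subseteq> multi_indices d"
    and tail: "\<And>B. finite B \<Longrightarrow> B \<subseteq> multi_indices d - A \<Longrightarrow> (\<Sum>\<alpha>\<in>B. Taylor_weight \<gamma> d \<alpha>) \<le> \<epsilon>"
  shows "minimal_error \<gamma> algs (card A) d \<le> ereal \<epsilon>"
  unfolding minimal_error_def
proof (rule INF_lower2)
  let ?A = "\<lambda>f x. \<Sum>\<alpha>\<in>A. multi_deriv d \<alpha> f (origin d) * monomial d \<alpha> x"
  show "?A \<in> algs d (card A)"
    using algs Taylor_algorithm[OF A] by auto
  show "(SUP f \<in> {f \<in> F \<gamma> d. F_norm \<gamma> d f \<le> 1}. Linf_norm d (\<lambda>x. f x - ?A f x)) \<le> ereal \<epsilon>"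
  proof (rule SUP_least)
    fix f assume "f \<in> {f \<in> F \<gamma> d. F_norm \<gamma> d f \<le> 1}"
    then have f: "smooth_on_cube d f" "F_norm \<gamma> d f \<le> 1" by (simp_all add: F_def)
    show "Linf_norm d (\<lambda>x. f x - ?A f x) \<le> ereal \<epsilon>"
    proof (rule Linf_norm_le)
      show "continuous_on (cube d) (\<lambda>x. f x - ?A f x)"
        by (intro continuous_intros smooth_on_cubeD(1)[OF f(1)] continuous_on_monomial)
      show "\<bar>f x - ?A f x\<bar> \<le> \<epsilon>" if "x \<in> cube d" for x
        using truncated_Taylor[OF f that A tail] .
    qed
  qed
qed

text \<open>
  The indices with \<open>Taylor_weight\<close> above \<open>\<tau> = (\<epsilon> / S)\<^bsup>1 / (1 - \<kappa>)\<^esup>\<close> are kept: by Markov's inequality there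
  are at most \<open>S / \<tau>\<^bsup>\<kappa>\<^esup>\<close> of them, and the others contribute at most \<open>\<tau>\<^bsup>1 - \<kappa>\<^esup> * S = \<epsilon>\<close>.
\<close>

lemma complexity_le:
  assumes algs: "algs = linear_algorithms \<gamma> \<or> algs = nonlinear_algorithms \<gamma>"
    and \<kappa>: "0 < \<kappa>" "\<kappa> < 1" and \<epsilon>: "\<epsilon> > 0" and S: "S > 0"
    and sum: "\<And>B. finite B \<Longrightarrow> B \<subseteq> multi_indices d \<Longrightarrow> (\<Sum>\<alpha>\<in>B. Taylor_weight \<gamma> d \<alpha> powr \<kappa>) \<le> S"
  shows "\<exists>n. minimal_error \<gamma> algs n d \<le> ereal \<epsilon> \<and> real n \<le> S * (S / \<epsilon>) powr (\<kappa> / (1 - \<kappa>))"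
proof -
  define \<tau> where "\<tau> = (\<epsilon> / S) powr (1 / (1 - \<kappa>))"
  have \<tau>: "\<tau> > 0" using \<epsilon> S by (simp add: \<tau>_def)
  let ?w = "Taylor_weight \<gamma> d"
  define A where "A = {\<alpha> \<in> multi_indices d. \<tau> < ?w \<alpha>}"
  have card_le: "real (card B) \<le> S / \<tau> powr \<kappa>" if B: "finite B" "B \<subseteq> A" for B
  proof -
    have "real (card B) * \<tau> powr \<kappa> = (\<Sum>\<alpha>\<in>B. \<tau> powr \<kappa>)" by simp
    also have "\<dots> \<le> (\<Sum>\<alpha>\<in>B. ?w \<alpha> powr \<kappa>)"
      by (intro sum_mono powr_mono2) (use \<kappa> \<tau> B in \<open>auto simp: A_def\<close>)
    also have "\<dots> \<le> S" by (rule sum) (use B in \<open>auto simp: A_def\<close>)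
    finally show ?thesis using \<tau> by (simp add: pos_le_divide_eq)
  qed
  \<comment> \<open>The bound on the cardinality of finite subsets is uniform, hence also gives
    finiteness of \<open>A\<close>.\<close>
  have finA: "finite A"
  proof (rule finite_if_finite_subsets_card_bdd[of A "nat \<lfloor>S / \<tau> powr \<kappa>\<rfloor>", THEN conjunct1])
    fix B assume "B \<subseteq> A" "finite B"
    then show "card B \<le> nat \<lfloor>S / \<tau> powr \<kappa>\<rfloor>"
      using card_le by (simp add: le_nat_floor)
  qed
  have "minimal_error \<gamma> algs (card A) d \<le> ereal \<epsilon>"
  proof (rule minimal_error_le[OF algs finA])
    show "A \<subseteq> multi_indices d" by (auto simp: A_def)
    fix B assume B: "finite B" "B \<subseteq> multi_indices d - A"
    have "(\<Sum>\<alpha>\<in>B. ?w \<alpha>) \<le> (\<Sum>\<alpha>\<in>B. \<tau> powr (1 - \<kappa>) * ?w \<alpha> powr \<kappa>)"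
    proof (rule sum_mono)
      fix \<alpha> assume "\<alpha> \<in> B"
      then have le: "?w \<alpha> \<le> \<tau>" using B(2) by (auto simp: A_def)
      have "?w \<alpha> = ?w \<alpha> powr (1 - \<kappa>) * ?w \<alpha> powr \<kappa>"
        using Taylor_weight_pos[of \<alpha>] by (simp add: powr_add[symmetric])
      also have "\<dots> \<le> \<tau> powr (1 - \<kappa>) * ?w \<alpha> powr \<kappa>"
        using Taylor_weight_pos[of \<alpha>] le \<kappa> by (intro mult_right_mono powr_mono2) auto
      finally show "?w \<alpha> \<le> \<tau> powr (1 - \<kappa>) * ?w \<alpha> powr \<kappa>" .
    qed
    also have "\<dots> = \<tau> powr (1 - \<kappa>) * (\<Sum>\<alpha>\<in>B. ?w \<alpha> powr \<kappa>)" by (rule sum_distrib_left[symmetric])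
    also have "\<dots> \<le> \<tau> powr (1 - \<kappa>) * S"
      using B by (intro mult_left_mono sum) auto
    also have "\<tau> powr (1 - \<kappa>) = \<epsilon> / S"
      using \<kappa> \<epsilon> S by (simp add: \<tau>_def powr_powr)
    finally show "(\<Sum>\<alpha>\<in>B. ?w \<alpha>) \<le> \<epsilon>" using S by simp
  qed
  moreover have "S / \<tau> powr \<kappa> = S * (S / \<epsilon>) powr (\<kappa> / (1 - \<kappa>))"
  proof -
    have "\<tau> powr \<kappa> = (\<epsilon> / S) powr (\<kappa> / (1 - \<kappa>))"
      by (simp add: \<tau>_def powr_powr)
    moreover have "inverse ((\<epsilon> / S) powr (\<kappa> / (1 - \<kappa>))) = (S / \<epsilon>) powr (\<kappa> / (1 - \<kappa>))"
      using \<epsilon> S by (simp add: powr_divide)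
    ultimately show ?thesis by (simp add: divide_inverse)
  qed
  ultimately show ?thesis
    using card_le[OF finA order.refl] by auto
qed

end

section \<open>Asymptotics\<close>

text \<open>What remains of the terms of positive order in
  \<open>(t ^ k / fact k) powr \<kappa>\<close> after \<open>t powr \<kappa>\<close> is factored out
  and the other powers of \<open>t\<close> are bounded by those of \<open>C\<close>.\<close>

definition Taylor_weight_const :: "real \<Rightarrow> real \<Rightarrow> real" where
  "Taylor_weight_const \<kappa> C = (\<Sum>k. (C ^ k / fact (Suc k)) powr \<kappa>)"

lemma summable_Taylor_weight_const:
  fixes \<kappa> C :: real
  assumes "0 < \<kappa>" "0 < C"
  shows "summable (\<lambda>k. (C ^ k / fact (Suc k)) powr \<kappa>)"
proof (rule summable_ratio_test)
  \<comment> \<open>Chosen so that \<open>?q powr \<kappa> = 1/2\<close>; the ratio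
    \<open>C / real (Suc (Suc k))\<close> of the bases is eventually below
    \<open>?q\<close>.\<close>
  let ?q = "(1/2 :: real) powr (1 / \<kappa>)"
  show "(1/2 :: real) < 1" by simp
  fix k assume "k \<ge> nat \<lceil>C / ?q\<rceil>"
  then have "C / ?q \<le> real k" by linarith
  also have "\<dots> \<le> real (Suc (Suc k))" by simp
  finally have "C / real (Suc (Suc k)) \<le> ?q"
    by (simp only: pos_divide_le_eq of_nat_0_less_iff zero_less_Suc) (simp add: pos_divide_le_eq mult.commute)
  then have "(C / real (Suc (Suc k))) powr \<kappa> \<le> ?q powr \<kappa>"
    using assms by (intro powr_mono2) auto
  also have "?q powr \<kappa> = 1/2" using assms by (simp add: powr_powr)
  finally have q: "(C / real (Suc (Suc k))) powr \<kappa> \<le> 1/2" .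
  have "C ^ Suc k / fact (Suc (Suc k)) = (C / real (Suc (Suc k))) * (C ^ k / fact (Suc k))"
    unfolding power_Suc fact_Suc[of "Suc k"] by simp
  then have "(C ^ Suc k / fact (Suc (Suc k))) powr \<kappa> =
      (C / real (Suc (Suc k))) powr \<kappa> * (C ^ k / fact (Suc k)) powr \<kappa>"
    using assms by (simp only: powr_mult)
  also have "\<dots> \<le> 1/2 * (C ^ k / fact (Suc k)) powr \<kappa>"
    by (rule mult_right_mono[OF q]) simp
  finally show "norm ((C ^ Suc k / fact (Suc (Suc k))) powr \<kappa>) \<le> 1/2 * norm ((C ^ k / fact (Suc k)) powr \<kappa>)"
    by (simp only: real_norm_def abs_of_nonneg powr_ge_zero)
qed

text \<open>The term of order 0 is exactly 1, which leaves \<open>1 + c * t powr \<kappa>\<close>.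
  It matters that no constant stands in front of the exponential: in the product over the
  coordinates it would be raised to the power \<open>d\<close>.\<close>

lemma sum_powr_le_exp:
  assumes \<kappa>: "0 < \<kappa>" and t: "0 < t" "t \<le> C"
  shows "(\<Sum>k\<le>K. (t ^ k / fact k) powr \<kappa>) \<le> exp (Taylor_weight_const \<kappa> C * t powr \<kappa>)"
proof -
  have "(\<Sum>k\<le>K. (t ^ k / fact k) powr \<kappa>) = 1 + (\<Sum>k<K. (t ^ Suc k / fact (Suc k)) powr \<kappa>)"
    by (subst sum.atMost_shift) simp
  also have "(\<Sum>k<K. (t ^ Suc k / fact (Suc k)) powr \<kappa>) \<le> (\<Sum>k<K. t powr \<kappa> * (C ^ k / fact (Suc k)) powr \<kappa>)"
  proof (rule sum_mono)
    fix k
    have "(t ^ Suc k / fact (Suc k)) powr \<kappa> = (t * (t ^ k / fact (Suc k))) powr \<kappa>" by simp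
    also have "\<dots> = t powr \<kappa> * (t ^ k / fact (Suc k)) powr \<kappa>"
      using t by (subst powr_mult) simp_all
    also have "\<dots> \<le> t powr \<kappa> * (C ^ k / fact (Suc k)) powr \<kappa>"
      using \<kappa> t by (intro mult_left_mono powr_mono2 divide_right_mono power_mono) auto
    finally show "(t ^ Suc k / fact (Suc k)) powr \<kappa> \<le> t powr \<kappa> * (C ^ k / fact (Suc k)) powr \<kappa>" .
  qed
  also have "\<dots> = t powr \<kappa> * (\<Sum>k<K. (C ^ k / fact (Suc k)) powr \<kappa>)"
    by (rule sum_distrib_left[symmetric])
  also have "\<dots> \<le> t powr \<kappa> * Taylor_weight_const \<kappa> C"
    unfolding Taylor_weight_const_def using \<kappa> t
    by (intro mult_left_mono sum_le_suminf summable_Taylor_weight_const) auto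
  also have "1 + t powr \<kappa> * Taylor_weight_const \<kappa> C \<le> exp (Taylor_weight_const \<kappa> C * t powr \<kappa>)"
    using exp_ge_add_one_self[of "Taylor_weight_const \<kappa> C * t powr \<kappa>"] by (simp add: mult.commute)
  finally show ?thesis by simp
qed

lemma Taylor_weight_const_nonneg: "0 < \<kappa> \<Longrightarrow> 0 < C \<Longrightarrow> 0 \<le> Taylor_weight_const \<kappa> C"
  unfolding Taylor_weight_const_def by (intro suminf_nonneg summable_Taylor_weight_const) auto

context positive_weights
begin

lemma sum_Taylor_weight_powr_le:
  assumes \<kappa>: "0 < \<kappa>" and C: "\<And>j. j \<in> {1..d} \<Longrightarrow> \<gamma> d j \<le> C"
    and B: "finite B" "B \<subseteq> multi_indices d"
  shows "(\<Sum>\<alpha>\<in>B. Taylor_weight \<gamma> d \<alpha> powr \<kappa>) \<le> exp (Taylor_weight_const \<kappa> C * (\<Sum>j=1..d. \<gamma> d j powr \<kappa>))"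
proof -
  obtain K where "\<forall>L\<ge>K. B \<subseteq> {1..d} \<rightarrow>\<^sub>E {..L}"
    using multi_indices_box[OF B] by (elim exE)
  then have K: "B \<subseteq> {1..d} \<rightarrow>\<^sub>E {..K}" by simp
  have fin: "finite ({1..d} \<rightarrow>\<^sub>E {..K})" by (intro finite_PiE) auto
  have "(\<Sum>\<alpha>\<in>B. Taylor_weight \<gamma> d \<alpha> powr \<kappa>) \<le> (\<Sum>\<alpha>\<in>{1..d} \<rightarrow>\<^sub>E {..K}. Taylor_weight \<gamma> d \<alpha> powr \<kappa>)"
    by (intro sum_mono2 fin K) simp
  also have "\<dots> = (\<Sum>\<alpha>\<in>{1..d} \<rightarrow>\<^sub>E {..K}. \<Prod>j=1..d. (\<gamma> d j ^ \<alpha> j / fact (\<alpha> j)) powr \<kappa>)"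
    unfolding Taylor_weight_def
    by (intro sum.cong refl prod_powr_distrib)
  also have "\<dots> = (\<Prod>j=1..d. \<Sum>k\<le>K. (\<gamma> d j ^ k / fact k) powr \<kappa>)"
    by (rule prod_sum_PiE[symmetric]) auto
  also have "\<dots> \<le> (\<Prod>j=1..d. exp (Taylor_weight_const \<kappa> C * \<gamma> d j powr \<kappa>))"
    by (intro prod_mono conjI sum_nonneg sum_powr_le_exp \<kappa> pos C) auto
  also have "\<dots> = exp (Taylor_weight_const \<kappa> C * (\<Sum>j=1..d. \<gamma> d j powr \<kappa>))"
    by (simp add: exp_sum sum_distrib_left)
  finally show ?thesis .
qed

lemma minimal_error_le_exists:
  assumes algs: "algs = linear_algorithms \<gamma> \<or> algs = nonlinear_algorithms \<gamma>"
    and \<kappa>: "0 < \<kappa>" "\<kappa> < 1" and C: "\<And>j. j \<in> {1..d} \<Longrightarrow> \<gamma> d j \<le> C" and \<epsilon>: "0 < \<epsilon>"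
  shows "\<exists>n. minimal_error \<gamma> algs n d \<le> ereal \<epsilon> \<and> real n \<le>
    exp (Taylor_weight_const \<kappa> C * (\<Sum>j=1..d. \<gamma> d j powr \<kappa>)) *
      (exp (Taylor_weight_const \<kappa> C * (\<Sum>j=1..d. \<gamma> d j powr \<kappa>)) / \<epsilon>) powr (\<kappa> / (1 - \<kappa>))"
  by (rule complexity_le[OF algs \<kappa> \<epsilon>]) (use sum_Taylor_weight_powr_le[OF \<kappa>(1) C] in auto)

lemma ln_information_complexity_le:
  assumes algs: "algs = linear_algorithms \<gamma> \<or> algs = nonlinear_algorithms \<gamma>"
    and \<kappa>: "0 < \<kappa>" "\<kappa> < 1" and C: "\<And>j. j \<in> {1..d} \<Longrightarrow> \<gamma> d j \<le> C" "0 < C" and \<epsilon>: "0 < \<epsilon>" "\<epsilon> \<le> 1"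
  shows "ln (real (information_complexity \<gamma> algs \<epsilon> d)) \<le>
    (Taylor_weight_const \<kappa> C * (\<Sum>j=1..d. \<gamma> d j powr \<kappa>) + ln (1 / \<epsilon>)) / (1 - \<kappa>)"
proof -
  define \<sigma> where "\<sigma> = Taylor_weight_const \<kappa> C * (\<Sum>j=1..d. \<gamma> d j powr \<kappa>)"
  have \<sigma>: "\<sigma> \<ge> 0"
    unfolding \<sigma>_def using \<kappa> C by (intro mult_nonneg_nonneg Taylor_weight_const_nonneg sum_nonneg) auto
  have l\<epsilon>: "ln (1 / \<epsilon>) \<ge> 0" using \<epsilon> by simp
  obtain n where n: "minimal_error \<gamma> algs n d \<le> ereal \<epsilon>" "real n \<le> exp \<sigma> * (exp \<sigma> / \<epsilon>) powr (\<kappa> / (1 - \<kappa>))"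
    using minimal_error_le_exists[OF algs \<kappa> C(1) \<epsilon>(1)] unfolding \<sigma>_def by blast
  define N where "N = information_complexity \<gamma> algs \<epsilon> d"
  have "N \<le> n"
    unfolding N_def information_complexity_def by (rule Least_le) (rule n(1))
  then have N: "real N \<le> exp \<sigma> * (exp \<sigma> / \<epsilon>) powr (\<kappa> / (1 - \<kappa>))"
    using n(2) by linarith
  have "ln (real N) \<le> (\<sigma> + ln (1 / \<epsilon>)) / (1 - \<kappa>)"
  \<comment> \<open>For \<open>N = 0\<close> the left side is \<open>ln 0\<close>, which is 0 by
    convention.\<close>
  proof (cases "N = 0")
    case True
    then show ?thesis using \<sigma> l\<epsilon> \<kappa> by simp
  next
    case False
    have "ln (real N) \<le> ln (exp \<sigma> * (exp \<sigma> / \<epsilon>) powr (\<kappa> / (1 - \<kappa>)))"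
      using False N \<epsilon> by (subst ln_le_cancel_iff) auto
    also have "\<dots> = \<sigma> + \<kappa> / (1 - \<kappa>) * (\<sigma> + ln (1 / \<epsilon>))"
      using \<epsilon> by (simp add: ln_mult ln_powr ln_div)
    also have "\<dots> = (\<sigma> + \<kappa> * ln (1 / \<epsilon>)) / (1 - \<kappa>)"
      using \<kappa> by (simp add: field_simps)
    also have "\<dots> \<le> (\<sigma> + ln (1 / \<epsilon>)) / (1 - \<kappa>)"
      using \<kappa> mult_right_mono[OF less_imp_le[OF \<kappa>(2)] l\<epsilon>] by (intro divide_right_mono) auto
    finally show ?thesis .
  qed
  then show ?thesis unfolding N_def \<sigma>_def .
qed

lemma minimal_error_0_le_1:
  assumes algs: "algs = linear_algorithms \<gamma> \<or> algs = nonlinear_algorithms \<gamma>"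
  shows "minimal_error \<gamma> algs 0 d \<le> 1"
  unfolding minimal_error_def
proof (rule INF_lower2)
  show "(\<lambda>f x. 0) \<in> algs d 0"
    using algs Taylor_algorithm[of "{}"] by auto
  show "(SUP f \<in> {f \<in> F \<gamma> d. F_norm \<gamma> d f \<le> 1}. Linf_norm d (\<lambda>x. f x - 0)) \<le> 1"
  proof (rule SUP_least)
    fix f assume "f \<in> {f \<in> F \<gamma> d. F_norm \<gamma> d f \<le> 1}"
    then have f: "smooth_on_cube d f" "F_norm \<gamma> d f \<le> ereal 1" by (simp_all add: F_def one_ereal_def)
    let ?z = "restrict (\<lambda>_. 0) {1..d} :: nat \<Rightarrow> nat"
    have z: "?z \<in> multi_indices d" by (simp add: multi_indices_def)
    have "index_list ?z d = index_list ?z 0"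
      by (rule index_list_zeros) auto
    then have "multi_deriv d ?z f = f" "weight \<gamma> d ?z = 1"
      by (simp_all add: multi_deriv_index_list weight_def)
    then have "\<bar>f x\<bar> \<le> 1" if "x \<in> cube d" for x
      using F_normD[OF f z that] by simp
    then show "Linf_norm d (\<lambda>x. f x - 0) \<le> 1"
      using Linf_norm_le[OF smooth_on_cubeD(1)[OF f(1)], of 1] by (simp add: one_ereal_def)
  qed
qed

lemma initial_error_ge_1:
  assumes algs: "algs = linear_algorithms \<gamma> \<or> algs = nonlinear_algorithms \<gamma>"
  shows "1 \<le> initial_error \<gamma> algs d"
proof -
  \<comment> \<open>With \<open>s = 0\<close> there are no blocks, so the condition on large weights
    is void, and \<open>0 < 2 ^ 0\<close> admits \<open>n = 0\<close>.\<close>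
  interpret weighted_blocks \<gamma> 1 0 d
    by unfold_locales auto
  show ?thesis
    unfolding initial_error_def using minimal_error_ge_1[OF _ algs, of 0] by simp
qed

end

text \<open>The dimensions of a sequence in \<open>weakly_tractable\<close> may stay bounded while
  \<open>T\<close> grows through \<open>1 / \<epsilon> k\<close>. Hence the bound
  \<open>r / 2 * real d + M\<close> valid for every \<open>d\<close>, whose constant is absorbed by
  \<open>T\<close>.\<close>

lemma sublinear_quotient_tendsto_0:
  fixes h :: "nat \<Rightarrow> real" and T :: "nat \<Rightarrow> real" and D :: "nat \<Rightarrow> nat"
  assumes h: "(\<lambda>d. h d / real d) \<longlonglongrightarrow> 0" and h0: "\<And>d. 0 \<le> h d"
    and T: "filterlim T at_top sequentially" and D: "\<And>k. real (D k) \<le> T k"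
  shows "(\<lambda>k. h (D k) / T k) \<longlonglongrightarrow> 0"
proof (rule LIMSEQ_I)
  fix r :: real assume r: "r > 0"
  obtain N where N: "\<forall>d\<ge>N. norm (h d / real d - 0) < r / 2"
    using LIMSEQ_D[OF h, of "r / 2"] r by auto
  \<comment> \<open>\<open>h 0\<close> is added separately: the quotient at 0 is 0 by convention and
    says nothing about \<open>h 0\<close>, and \<open>N\<close> may be 0.\<close>
  define M where "M = h 0 + (\<Sum>d<N. h d)"
  have hM: "h d \<le> r / 2 * real d + M" for d
  proof (cases "d \<ge> N \<and> d \<noteq> 0")
    case True
    then have "h d / real d < r / 2" using N h0[of d] by auto
    then have "h d \<le> r / 2 * real d" using True by (simp add: pos_divide_less_eq)
    moreover have "0 \<le> M" unfolding M_def by (intro add_nonneg_nonneg sum_nonneg h0)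
    ultimately show ?thesis by simp
  next
    case False
    have "h d \<le> M"
    proof (cases "d = 0")
      case True
      then show ?thesis unfolding M_def using sum_nonneg[of "{..<N}" h] h0 by simp
    next
      case False
      then have "h d \<le> (\<Sum>d<N. h d)"
        using \<open>\<not> (d \<ge> N \<and> d \<noteq> 0)\<close> h0 by (intro member_le_sum) auto
      then show ?thesis unfolding M_def using h0[of 0] by simp
    qed
    then show ?thesis using r by (simp add: add_increasing)
  qed
  have "eventually (\<lambda>k. T k \<ge> max 1 (4 * \<bar>M\<bar> / r)) sequentially"
    using T unfolding filterlim_at_top by blast
  then obtain K where K: "\<forall>k\<ge>K. T k \<ge> max 1 (4 * \<bar>M\<bar> / r)"
    unfolding eventually_sequentially by blast
  show "\<exists>K. \<forall>k\<ge>K. norm (h (D k) / T k - 0) < r"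
  proof (intro exI[of _ K] allI impI)
    fix k assume "k \<ge> K"
    then have Tk: "T k \<ge> 1" "4 * \<bar>M\<bar> / r \<le> T k" using K by auto
    have "M \<le> r / 4 * T k"
      using Tk(2) r by (simp add: pos_divide_le_eq mult.commute)
    then have "h (D k) \<le> r / 2 * T k + r / 4 * T k"
      using hM[of "D k"] mult_left_mono[OF D[of k], of "r / 2"] r by linarith
    also have "\<dots> < r * T k" using Tk(1) r by simp
    finally have "h (D k) / T k < r" using Tk(1) by (simp add: pos_divide_less_eq)
    then show "norm (h (D k) / T k - 0) < r" using h0[of "D k"] Tk(1) by simp
  qed
qed

section \<open>The implications between tractability, curse and averages\<close>

lemma weakly_tractableI:
  fixes \<gamma> :: "nat \<Rightarrow> nat \<Rightarrow> real"
  assumes pos: "\<And>d j. j \<in> {1..d} \<Longrightarrow> \<gamma> d j > 0" and C: "\<And>d j. j \<in> {1..d} \<Longrightarrow> \<gamma> d j \<le> C" "0 < C"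
    and algs: "algs = linear_algorithms \<gamma> \<or> algs = nonlinear_algorithms \<gamma>"
    and \<kappa>: "0 < \<kappa>" "\<kappa> < 1"
    and lim: "(\<lambda>d. (1 / real d) * (\<Sum>j=1..d. \<gamma> d j powr \<kappa>)) \<longlonglongrightarrow> 0"
  shows "weakly_tractable \<gamma> algs"
  unfolding weakly_tractable_def
proof (intro allI impI)
  fix \<epsilon> :: "nat \<Rightarrow> real" and d :: "nat \<Rightarrow> nat"
  assume "\<forall>k. 0 < \<epsilon> k \<and> \<epsilon> k \<le> 1 \<and> d k \<ge> 1 \<and> ereal (\<epsilon> k) < initial_error \<gamma> algs (d k)"
  then have \<epsilon>: "0 < \<epsilon> k" "\<epsilon> k \<le> 1" for k by auto
  define T where "T k = 1 / \<epsilon> k + real (d k)" for k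
  assume "filterlim (\<lambda>k. 1 / \<epsilon> k + real (d k)) at_top sequentially"
  then have T: "filterlim T at_top sequentially" by (simp add: T_def[abs_def])
  define s where "s d = (\<Sum>j=1..d. \<gamma> d j powr \<kappa>)" for d
  define c where "c = Taylor_weight_const \<kappa> C"
  define X where "X k = ln (real (information_complexity \<gamma> algs (\<epsilon> k) (d k)))" for k
  have X: "X k \<le> (c * s (d k) + ln (1 / \<epsilon> k)) / (1 - \<kappa>)" for k
  proof -
    interpret positive_weights \<gamma> "d k" by unfold_locales (rule pos)
    show ?thesis
      unfolding X_def c_def s_def by (rule ln_information_complexity_le[OF algs \<kappa> C \<epsilon>])
  qed
  have X0: "0 \<le> X k" for k
    unfolding X_def by (cases "information_complexity \<gamma> algs (\<epsilon> k) (d k) = 0") auto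
  have T1: "1 \<le> T k" "1 / \<epsilon> k \<le> T k" "real (d k) \<le> T k" for k
  proof -
    have "1 \<le> 1 / \<epsilon> k" using \<epsilon>[of k] by simp
    then show "1 \<le> T k" "1 / \<epsilon> k \<le> T k" "real (d k) \<le> T k"
      unfolding T_def using less_imp_le[OF \<epsilon>(1)[of k]] by simp_all
  qed
  have "(\<lambda>d. s d / real d) \<longlonglongrightarrow> 0"
    using lim by (simp add: s_def)
  then have l1: "(\<lambda>k. s (d k) / T k) \<longlonglongrightarrow> 0"
    by (rule sublinear_quotient_tendsto_0) (use T T1 in \<open>auto simp: s_def intro: sum_nonneg\<close>)
  \<comment> \<open>This covers the accuracy: \<open>1 / \<epsilon> k \<le> T k\<close>, so its
    logarithm is at most \<open>ln (T k)\<close>.\<close>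
  have l2: "(\<lambda>k. ln (T k) / T k) \<longlonglongrightarrow> 0"
    by (rule filterlim_compose[OF ln_x_over_x_tendsto_0 T])
  have "(\<lambda>k. (c * (s (d k) / T k) + ln (T k) / T k) / (1 - \<kappa>)) \<longlonglongrightarrow> (c * 0 + 0) / (1 - \<kappa>)"
    by (intro tendsto_intros l1 l2) (use \<kappa> in simp)
  then have lim0: "(\<lambda>k. (c * (s (d k) / T k) + ln (T k) / T k) / (1 - \<kappa>)) \<longlonglongrightarrow> 0" by simp
  have "(\<lambda>k. X k / T k) \<longlonglongrightarrow> 0"
  proof (rule tendsto_sandwich[OF _ _ tendsto_const lim0])
    show "\<forall>\<^sub>F k in sequentially. 0 \<le> X k / T k"
    proof (intro always_eventually allI)
      show "0 \<le> X k / T k" for k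
        using X0[of k] T1(1)[of k] by simp
    qed
    show "\<forall>\<^sub>F k in sequentially. X k / T k \<le> (c * (s (d k) / T k) + ln (T k) / T k) / (1 - \<kappa>)"
    proof (intro always_eventually allI)
      fix k
      have "ln (1 / \<epsilon> k) \<le> ln (T k)"
        using \<epsilon>[of k] T1[of k] by (intro ln_mono) auto
      then have "(c * s (d k) + ln (1 / \<epsilon> k)) / (1 - \<kappa>) \<le> (c * s (d k) + ln (T k)) / (1 - \<kappa>)"
        using \<kappa> by (intro divide_right_mono) auto
      with X[of k] have "X k \<le> (c * s (d k) + ln (T k)) / (1 - \<kappa>)" by linarith
      then have "X k / T k \<le> (c * s (d k) + ln (T k)) / (1 - \<kappa>) / T k"
        using T1(1)[of k] by (intro divide_right_mono) auto
      also have "\<dots> = (c * (s (d k) / T k) + ln (T k) / T k) / (1 - \<kappa>)"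
        by (simp add: add_divide_distrib mult.commute)
      finally show "X k / T k \<le> (c * (s (d k) / T k) + ln (T k) / T k) / (1 - \<kappa>)" .
    qed
  qed
  then show "(\<lambda>k. ln (real (information_complexity \<gamma> algs (\<epsilon> k) (d k))) / (1 / \<epsilon> k + real (d k))) \<longlonglongrightarrow> 0"
    unfolding X_def T_def .
qed

lemma weakly_tractable_imp_not_curse:
  fixes \<gamma> :: "nat \<Rightarrow> nat \<Rightarrow> real"
  assumes pos: "\<And>d j. j \<in> {1..d} \<Longrightarrow> \<gamma> d j > 0"
    and algs: "algs = linear_algorithms \<gamma> \<or> algs = nonlinear_algorithms \<gamma>"
    and wt: "weakly_tractable \<gamma> algs"
  shows "\<not> curse_of_dimensionality \<gamma> algs"
proof
  assume "curse_of_dimensionality \<gamma> algs"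
  then obtain \<epsilon> C \<beta> where \<epsilon>: "\<epsilon> > 0" and C: "C > 0" and \<beta>: "\<beta> > 0"
    and inf: "infinite {d. d \<ge> 1 \<and> real (information_complexity \<gamma> algs \<epsilon> d) \<ge> C * (1 + \<beta>) ^ d}"
    unfolding curse_of_dimensionality_def by blast
  obtain D :: "nat \<Rightarrow> nat" where D: "strict_mono D"
    and DS: "\<forall>k. D k \<in> {d. d \<ge> 1 \<and> real (information_complexity \<gamma> algs \<epsilon> d) \<ge> C * (1 + \<beta>) ^ d}"
    using infinite_enumerate[OF inf] by blast
  have D1: "D k \<ge> 1" and big: "C * (1 + \<beta>) ^ D k \<le> real (information_complexity \<gamma> algs \<epsilon> (D k))" for k
    using DS by auto
  have init: "1 \<le> initial_error \<gamma> algs d" "minimal_error \<gamma> algs 0 d \<le> 1" for d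
  proof -
    interpret positive_weights \<gamma> d by unfold_locales (rule pos)
    show "1 \<le> initial_error \<gamma> algs d" "minimal_error \<gamma> algs 0 d \<le> 1"
      by (rule initial_error_ge_1[OF algs], rule minimal_error_0_le_1[OF algs])
  qed
  have pos_big: "0 < C * (1 + \<beta>) ^ D k" for k
    using C \<beta> by simp
  \<comment> \<open>The curse allows any \<open>\<epsilon> > 0\<close>, weak tractability only those
    below the initial error. For \<open>\<epsilon> \<ge> 1\<close> the zero algorithm makes the
    complexity 0, which contradicts the curse.\<close>
  have "\<epsilon> < 1"
  proof (rule ccontr)
    assume "\<not> \<epsilon> < 1"
    then have "minimal_error \<gamma> algs 0 (D 0) \<le> ereal \<epsilon>"
      using init(2)[of "D 0"] by (intro order.trans[OF init(2)]) (simp add: one_ereal_def)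
    then have "information_complexity \<gamma> algs \<epsilon> (D 0) = 0"
      unfolding information_complexity_def by simp
    then show False using big[of 0] pos_big[of 0] by simp
  qed
  have "ereal \<epsilon> < initial_error \<gamma> algs (D k)" for k
    by (rule less_le_trans[OF _ init(1)]) (use \<open>\<epsilon> < 1\<close> in \<open>simp add: one_ereal_def\<close>)
  then have ad: "\<forall>k. 0 < \<epsilon> \<and> \<epsilon> \<le> 1 \<and> D k \<ge> 1 \<and> ereal \<epsilon> < initial_error \<gamma> algs (D k)"
    using \<epsilon> \<open>\<epsilon> < 1\<close> D1 by simp
  define T where "T k = 1 / \<epsilon> + real (D k)" for k
  define X where "X k = ln (real (information_complexity \<gamma> algs \<epsilon> (D k)))" for k
  have "filterlim (\<lambda>k. real (D k)) at_top sequentially"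
    by (rule filterlim_compose[OF filterlim_real_sequentially filterlim_subseq[OF D]])
  then have T: "filterlim T at_top sequentially"
    unfolding T_def by (intro filterlim_tendsto_add_at_top[OF tendsto_const])
  then have "filterlim (\<lambda>k. 1 / \<epsilon> + real (D k)) at_top sequentially"
    by (simp add: T_def[abs_def])
  with wt[unfolded weakly_tractable_def, rule_format, of "\<lambda>_. \<epsilon>" D] ad
  have l1: "(\<lambda>k. X k / T k) \<longlonglongrightarrow> 0" unfolding X_def T_def by blast
  define L where "L = ln (1 + \<beta>)"
  have L: "L > 0" using \<beta> by (simp add: L_def)
  \<comment> \<open>Chosen so that \<open>ln C + real (D k) * L = L * T k - ?M\<close>; thus
    \<open>X k / T k\<close> is at least \<open>L\<close> up to a vanishing term.\<close>
  let ?M = "L / \<epsilon> - ln C"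
  have "(\<lambda>k. ?M / T k) \<longlonglongrightarrow> 0"
    by (rule real_tendsto_divide_at_top[OF tendsto_const T])
  with l1 have lim: "(\<lambda>k. X k / T k + ?M / T k) \<longlonglongrightarrow> 0 + 0" by (rule tendsto_add)
  have "L \<le> X k / T k + ?M / T k" for k
  proof -
    have Tk: "T k > 0" unfolding T_def using \<epsilon> by (simp add: add_pos_nonneg)
    have "ln (C * (1 + \<beta>) ^ D k) \<le> X k"
      unfolding X_def using big[of k] pos_big[of k] by (intro ln_mono) auto
    then have "ln C + real (D k) * L \<le> X k"
      using C \<beta> by (simp add: ln_mult ln_realpow L_def)
    then have "L * T k \<le> X k + ?M"
      by (simp add: T_def algebra_simps)
    then show ?thesis
      using Tk by (simp add: pos_le_divide_eq add_divide_distrib[symmetric])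
  qed
  then have "L \<le> 0 + 0"
    by (intro LIMSEQ_le_const[OF lim]) blast
  with L show False by simp
qed

lemma not_curse_imp_limit:
  fixes \<gamma> :: "nat \<Rightarrow> nat \<Rightarrow> real"
  assumes pos: "\<And>d j. j \<in> {1..d} \<Longrightarrow> \<gamma> d j > 0" and C: "\<And>d j. j \<in> {1..d} \<Longrightarrow> \<gamma> d j \<le> C" "0 < C"
    and decreasing: "\<And>d i j. 1 \<le> i \<Longrightarrow> i \<le> j \<Longrightarrow> j \<le> d \<Longrightarrow> \<gamma> d j \<le> \<gamma> d i"
    and algs: "algs = linear_algorithms \<gamma> \<or> algs = nonlinear_algorithms \<gamma>"
    and no_curse: "\<not> curse_of_dimensionality \<gamma> algs" and \<kappa>: "0 < \<kappa>"
  shows "(\<lambda>d. (1 / real d) * (\<Sum>j=1..d. \<gamma> d j powr \<kappa>)) \<longlonglongrightarrow> 0"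
proof (rule ccontr)
  let ?a = "\<lambda>d. (1 / real d) * (\<Sum>j=1..d. \<gamma> d j powr \<kappa>)"
  have a0: "0 \<le> ?a d" for d by (intro mult_nonneg_nonneg sum_nonneg) auto
  assume "\<not> ?a \<longlonglongrightarrow> 0"
  then obtain \<delta> where \<delta>: "\<delta> > 0" and not_small: "\<forall>N. \<exists>d\<ge>N. \<not> norm (?a d - 0) < \<delta>"
    unfolding LIMSEQ_iff by blast
  have freq: "\<exists>d\<ge>N. \<delta> \<le> ?a d" for N
  proof -
    obtain d where "d \<ge> N" "\<not> norm (?a d - 0) < \<delta>" using not_small by blast
    then show ?thesis using a0[of d] by (intro exI[of _ d]) (simp only: real_norm_def diff_zero abs_of_nonneg not_less simp_thms)
  qed
  \<comment> \<open>Weights below \<open>g\<close> have \<kappa>-th power below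
    \<open>\<delta> / 2\<close> and contribute at most \<open>\<delta> / 2\<close> to the average.
    The rest of the average comes from weights at least \<open>g\<close>, each with a \<kappa>-th
    power of at most \<open>C powr \<kappa>\<close>.\<close>
  define g where "g = (\<delta> / 2) powr (1 / \<kappa>)"
  have g: "g > 0" using \<delta> by (simp add: g_def)
  define m where "m = nat \<lceil>2 / g\<rceil>"
  have "2 / g \<le> real m" unfolding m_def by linarith
  moreover have "0 < 2 / g" using g by simp
  ultimately have "0 < real m" by linarith
  then have m: "m > 0" by simp
  with \<open>2 / g \<le> real m\<close> have mg: "2 / real m \<le> g"
    using g by (simp add: pos_divide_le_eq mult.commute)
  \<comment> \<open>At least \<open>\<theta> * real m * real d\<close> weights are large, which
    gives about \<open>\<theta> * real d\<close> blocks of length \<open>m\<close>.\<close>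
  define \<theta> where "\<theta> = \<delta> / (2 * C powr \<kappa> * real m)"
  have \<theta>: "\<theta> > 0" using \<delta> C m by (simp add: \<theta>_def)
  have key: "1/2 * (2 powr \<theta>) ^ d \<le> real (information_complexity \<gamma> algs (1/2) d)"
    if d: "d \<ge> 1" and a: "\<delta> \<le> ?a d" for d
  proof -
    define P where "P = {j \<in> {1..d}. \<delta> / 2 \<le> \<gamma> d j powr \<kappa>}"
    define p where "p = card P"
    have P: "finite P" "P \<subseteq> {1..d}" by (auto simp: P_def)
    have "p \<le> d" unfolding p_def using card_mono[OF _ P(2)] by simp
    have "\<delta> * real d \<le> (\<Sum>j=1..d. \<gamma> d j powr \<kappa>)"
      using a d by (simp add: pos_le_divide_eq)
    also have "\<dots> \<le> (\<Sum>j=1..d. (if j \<in> P then C powr \<kappa> else 0) + \<delta> / 2)"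
    proof (rule sum_mono)
      fix j assume j: "j \<in> {1..d}"
      show "\<gamma> d j powr \<kappa> \<le> (if j \<in> P then C powr \<kappa> else 0) + \<delta> / 2"
      proof (cases "j \<in> P")
        case True
        have "\<gamma> d j powr \<kappa> \<le> C powr \<kappa>"
          using pos[OF j] C(1)[OF j] \<kappa> by (intro powr_mono2) auto
        then show ?thesis using True \<delta> by simp
      qed (use j in \<open>simp add: P_def\<close>)
    qed
    also have "\<dots> = real p * C powr \<kappa> + \<delta> / 2 * real d"
    proof -
      have "(\<Sum>j=1..d. if j \<in> P then C powr \<kappa> else 0) = (\<Sum>j\<in>P. C powr \<kappa>)"
        using P by (simp only: sum.inter_restrict[symmetric] finite_atLeastAtMost Int_absorb1)
      then show ?thesis by (simp add: sum.distrib p_def)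
    qed
    finally have "\<delta> * real d \<le> 2 * (C powr \<kappa> * real p)" by (simp add: mult.commute)
    then have "\<delta> * real d / (2 * C powr \<kappa>) \<le> real p"
      using C(2) by (simp add: pos_divide_le_eq mult_ac)
    then have "\<delta> * real d / (2 * C powr \<kappa>) / real m \<le> real p / real m"
      using m by (intro divide_right_mono) auto
    then have pd: "\<theta> * real d \<le> real p / real m"
      by (simp add: \<theta>_def)
    \<comment> \<open>By monotonicity the \<open>p\<close> large weights are the first
      \<open>p\<close> ones: if weight number \<open>j \<le> p\<close> were small, all large ones
      would come before it and there would be fewer than \<open>p\<close>. So the blocks can start
      at coordinate 1.\<close>
    have large: "g \<le> \<gamma> d j" if j: "1 \<le> j" "j \<le> p" for j
    proof -
      have jd: "j \<in> {1..d}" using j \<open>p \<le> d\<close> by simp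
      have "\<delta> / 2 \<le> \<gamma> d j powr \<kappa>"
      proof (rule ccontr)
        assume less: "\<not> \<delta> / 2 \<le> \<gamma> d j powr \<kappa>"
        have "P \<subseteq> {1..<j}"
        proof
          fix i assume i: "i \<in> P"
          have "i < j"
          proof (rule ccontr)
            assume "\<not> i < j"
            then have "\<gamma> d i powr \<kappa> \<le> \<gamma> d j powr \<kappa>"
              using i j \<kappa> pos[of i d] by (intro powr_mono2 decreasing) (auto simp: P_def)
            then show False using less i by (simp add: P_def)
          qed
          then show "i \<in> {1..<j}" using i by (simp add: P_def)
        qed
        then have "p \<le> j - 1" unfolding p_def using card_mono[of "{1..<j}" P] by simp
        then show False using j by simp
      qed
      then have "(\<delta> / 2) powr (1 / \<kappa>) \<le> (\<gamma> d j powr \<kappa>) powr (1 / \<kappa>)"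
        using \<delta> \<kappa> by (intro powr_mono2) auto
      also have "\<dots> = \<gamma> d j" using pos[OF jd] \<kappa> by (simp add: powr_powr)
      finally show ?thesis unfolding g_def .
    qed
    define s where "s = p div m"
    have sm: "s * m \<le> p" unfolding s_def by simp
    interpret weighted_blocks \<gamma> m s d
    proof unfold_locales
      show "s * m \<le> d" using sm \<open>p \<le> d\<close> by simp
      show "2 / real m \<le> \<gamma> d j" if "1 \<le> j" "j \<le> s * m" for j
        using large[of j] that sm mg by linarith
    qed (use m pos in auto)
    have half: "(0::real) < 1/2" "(1/2::real) < 1" by simp_all
    \<comment> \<open>The complexity is a \<open>LEAST\<close>, which carries information only if
      some \<open>n\<close> reaches the error; the Taylor bound with exponent 1/2 supplies
      one.\<close>
    have "\<exists>n. minimal_error \<gamma> algs n d \<le> ereal (1/2)"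
      using minimal_error_le_exists[OF algs half C(1) half(1)] by blast
    then have "minimal_error \<gamma> algs (information_complexity \<gamma> algs (1/2) d) d \<le> ereal (1/2)"
      unfolding information_complexity_def by (rule LeastI_ex)
    also have "ereal (1/2) < 1" by (simp add: one_ereal_def)
    finally have "\<not> information_complexity \<gamma> algs (1/2) d < 2 ^ s"
      using minimal_error_ge_1[OF _ algs] by (auto simp: not_le[symmetric])
    then have "2 ^ s \<le> information_complexity \<gamma> algs (1/2) d" by simp
    then have "real (2 ^ s) \<le> real (information_complexity \<gamma> algs (1/2) d)"
      unfolding of_nat_le_iff .
    \<comment> \<open>The factor 1/2 pays for the rounding in \<open>s = p div m\<close>.\<close>
    moreover have "1/2 * (2 powr \<theta>) ^ d \<le> real (2 ^ s)"
    proof -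
      have "real p / real m < real s + 1"
      proof -
        have "p < (s + 1) * m"
          unfolding s_def using m dividend_less_div_times[of m p] by simp
        then have "real p < (real s + 1) * real m"
          by (metis of_nat_1 of_nat_add of_nat_less_iff of_nat_mult)
        then show ?thesis using m by (simp add: pos_divide_less_eq)
      qed
      with pd have "\<theta> * real d - 1 \<le> real s" by linarith
      then have "2 powr (\<theta> * real d - 1) \<le> 2 powr real s" by simp
      moreover have "2 powr (\<theta> * real d - 1) = 1/2 * (2 powr \<theta>) ^ d"
        by (simp add: powr_diff powr_powr powr_realpow[symmetric])
      moreover have "2 powr real s = real (2 ^ s)" by (simp add: powr_realpow)
      ultimately show ?thesis by simp
    qed
    ultimately show ?thesis by linarith
  qed
  have "infinite {d. d \<ge> 1 \<and> 1/2 * (1 + (2 powr \<theta> - 1)) ^ d \<le> real (information_complexity \<gamma> algs (1/2) d)}"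
    unfolding infinite_nat_iff_unbounded_le
  proof
    fix N
    obtain d where "d \<ge> max 1 N" "\<delta> \<le> ?a d" using freq by blast
    then show "\<exists>d\<ge>N. d \<in> {d. d \<ge> 1 \<and> 1/2 * (1 + (2 powr \<theta> - 1)) ^ d \<le> real (information_complexity \<gamma> algs (1/2) d)}"
      using key[of d] by (intro exI[of _ d]) simp
  qed
  moreover have "2 powr \<theta> - 1 > 0" using \<theta> by simp
  ultimately have "curse_of_dimensionality \<gamma> algs"
    unfolding curse_of_dimensionality_def
    by (intro exI[of _ "1/2"] exI[of _ "2 powr \<theta> - 1"] conjI) simp_all
  with no_curse show False by contradiction
qed

theorem theorem4:
  fixes \<gamma> :: "nat \<Rightarrow> nat \<Rightarrow> real" and C\<^sub>\<gamma> :: real and algs :: algorithm_class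
  assumes bounded: "\<And>d. d \<ge> 1 \<Longrightarrow> \<gamma> d 1 \<le> C\<^sub>\<gamma>"
    and decreasing: "\<And>d i j. 1 \<le> i \<Longrightarrow> i \<le> j \<Longrightarrow> j \<le> d \<Longrightarrow> \<gamma> d j \<le> \<gamma> d i"
    and positive: "\<And>d. d \<ge> 1 \<Longrightarrow> \<gamma> d d > 0"
    and admissible: "algs = linear_algorithms \<gamma> \<or> algs = nonlinear_algorithms \<gamma>"
  shows "(weakly_tractable \<gamma> algs \<longleftrightarrow> \<not> curse_of_dimensionality \<gamma> algs) \<and>
    (\<not> curse_of_dimensionality \<gamma> algs \<longleftrightarrow>
      (\<forall>\<kappa>::real. \<kappa> > 0 \<longrightarrow> (\<lambda>d. (1 / real d) * (\<Sum>j=1..d. \<gamma> d j powr \<kappa>)) \<longlonglongrightarrow> 0)) \<and>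
    ((\<forall>\<kappa>::real. \<kappa> > 0 \<longrightarrow> (\<lambda>d. (1 / real d) * (\<Sum>j=1..d. \<gamma> d j powr \<kappa>)) \<longlonglongrightarrow> 0) \<longleftrightarrow>
      (\<exists>\<kappa>::real. 0 < \<kappa> \<and> \<kappa> < 1 \<and> (\<lambda>d. (1 / real d) * (\<Sum>j=1..d. \<gamma> d j powr \<kappa>)) \<longlonglongrightarrow> 0))"
proof -
  let ?lim = "\<lambda>\<kappa>. (\<lambda>d. (1 / real d) * (\<Sum>j=1..d. \<gamma> d j powr \<kappa>)) \<longlonglongrightarrow> 0"
  have pos: "\<gamma> d j > 0" if "j \<in> {1..d}" for d j
    using positive[of d] decreasing[of j d d] that by force
  have C: "\<gamma> d j \<le> C\<^sub>\<gamma>" if "j \<in> {1..d}" for d j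
    using bounded[of d] decreasing[of 1 j d] that by force
  have C0: "0 < C\<^sub>\<gamma>"
    using bounded[of 1] positive[of 1] by simp
  have i_ii: "\<not> curse_of_dimensionality \<gamma> algs" if "weakly_tractable \<gamma> algs"
    by (rule weakly_tractable_imp_not_curse[OF pos admissible that])
  have ii_iii: "\<forall>\<kappa>::real. \<kappa> > 0 \<longrightarrow> ?lim \<kappa>" if "\<not> curse_of_dimensionality \<gamma> algs"
    by (intro allI impI not_curse_imp_limit[OF pos C C0 decreasing admissible that])
  have iii_iv: "\<exists>\<kappa>::real. 0 < \<kappa> \<and> \<kappa> < 1 \<and> ?lim \<kappa>" if "\<forall>\<kappa>::real. \<kappa> > 0 \<longrightarrow> ?lim \<kappa>"
    using that[rule_format, of "1/2"] by (intro exI[of _ "1/2"]) simp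
  have iv_i: "weakly_tractable \<gamma> algs" if iv: "\<exists>\<kappa>::real. 0 < \<kappa> \<and> \<kappa> < 1 \<and> ?lim \<kappa>"
  proof -
    obtain \<kappa> :: real where \<kappa>: "0 < \<kappa>" "\<kappa> < 1" "?lim \<kappa>"
      using iv by (elim exE conjE)
    show ?thesis by (rule weakly_tractableI[OF pos C C0 admissible \<kappa>])
  qed
  show ?thesis
    using i_ii ii_iii iii_iv iv_i by blast
qed

end
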